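(* If $a_2^{\{1,2\}}<0$, then $\psi_1'(1)=c_1\,a_1^{\{1\}}$ for some positive constant $c_1$. If $a_1^{\{1,2\}}<0$, then $\psi_2'(1)=c_2\,a_2^{\{2\}}$ for some positive constant $c_2$.
   Context: Let $\mathbb{H}=\{-1,0,1\}$, $\mathbb{H}_+=\{0,1\}$, $S_0=\{1,\dots,s_0\}$ finite. Let $A_{i,j}$ ($i,j\in\mathbb{H}$), $A^{(1)}_{i,j}$ ($i\in\mathbb{H},j\in\mathbb{H}_+$), $A^{(2)}_{i,j}$ ($i\in\mathbb{H}_+,j\in\mathbb{H}$), $A^{(0)}_{i,j}$ ($i,j\in\mathbb{H}_+$) be nonnegative $s_0\times s_0$ matrices such that each of the sums $A_{*,*}=\sum A_{i,j}$, $\sum A^{(1)}_{i,j}$, $\sum A^{(2)}_{i,j}$, $\sum A^{(0)}_{i,j}$ is stochastic. The 2d-QBD process $\{\boldsymbol Y_n\}$ is the Markov chain on $\mathbb{Z}_+^2\times S_0$ whose transition block from $(x_1,x_2)$ to $(x_1+i,x_2+j)$ is $A_{i,j}$ if $x_1,x_2\ne0$, $A^{(1)}_{i,j}$ if $x_1\neq0,x_2=0$, $A^{(2)}_{i,j}$ if $x_1=0,x_2\ne0$, $A^{(0)}_{i,j}$ if $x_1=x_2=0$ (with $i,j$ in the respective index ranges; other blocks are zero). $\{\tilde{\boldsymbol Y}_n\}$ is the chain on $\mathbb{Z}^2\times S_0$ with blocks $A_{i,j}$ everywhere; $\{\tilde{\boldsymbol Y}^{(1)}_n\}$ is the chain on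 $\mathbb{Z}\times\mathbb{Z}_+\times S_0$ with blocks $A_{i,j}$ if $x_2\ne0$ and $A^{(1)}_{i,j}$ if $x_2=0$; $\{\tilde{\boldsymbol Y}^{(2)}_n\}$ is the chain on $\mathbb{Z}_+\times\mathbb{Z}\times S_0$ with blocks $A_{i,j}$ if $x_1\neq0$ and $A^{(2)}_{i,j}$ if $x_1=0$. Drifts. Let $A_{k,*}=\sum_{l\in\mathbb{H}}A_{k,l}$, $A_{*,k}=\sum_{l\in\mathbb{H}}A_{l,k}$ ($k\in\mathbb H$), $A^{(1)}_{*,k}=\sum_{l\in\mathbb{H}}A^{(1)}_{l,k}$, $A^{(2)}_{k,*}=\sum_{l\in\mathbb{H}}A^{(2)}_{k,l}$ ($k\in\mathbb{H}_+$). Let $\boldsymbol\pi_{*,*}$ be the stationary distribution of $A_{*,*}$, $\mathbf 1$ the column vector of ones, and $a_1^{\{1,2\}}=\boldsymbol\pi_{*,*}(-A_{-1,*}+A_{1,*})\mathbf 1$, $a_2^{\{1,2\}}=\boldsymbol\pi_{*,*}(-A_{*,-1}+A_{*,1})\mathbf 1$. Let $A^{(1)}_*$ be the block tridiagonal stochastic matrix (blocks indexed by $\mathbb{Z}_+$) with first block row $(A^{(1)}_{*,0},A^{(1)}_{*,1},O,\dots)$ and every other block row having $A_{*,-1},A_{*,0},A_{*,1}$ on the sub-, main and super-diagonal; $A^{(2)}_*$ is defined likewise with first block row $(A^{(2)}_{0,*},A^{(2)}_{1,*},O,\dots)$ and blocks $A_{-1,*},A_{0,*},A_{1,*}$. $A^{(1)}_*$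 (resp. $A^{(2)}_*$) is positive recurrent iff $a^{\{1,2\}}_2<0$ (resp. $a^{\{1,2\}}_1<0$); its stationary distribution is then written $(\boldsymbol\pi^{(1)}_{*,k})_{k\ge0}$ (resp. $(\boldsymbol\pi^{(2)}_{*,k})_{k\ge0}$). Let $R^{(1)}_*$ be the minimal nonnegative solution of $X=A_{*,1}+XA_{*,0}+X^2A_{*,-1}$ and $R^{(2)}_*$ that of $X=A_{1,*}+XA_{0,*}+X^2A_{-1,*}$. When the stationary distributions exist, $a_1^{\{1\}}=\boldsymbol\pi^{(1)}_{*,0}(-A^{(1)}_{-1,0}-A^{(1)}_{-1,1}+A^{(1)}_{1,0}+A^{(1)}_{1,1})\mathbf 1+\boldsymbol\pi^{(1)}_{*,1}(I-R^{(1)}_* )^{-1}(-A_{-1,*}+A_{1,*})\mathbf 1$, $a_2^{\{2\}}=\boldsymbol\pi^{(2)}_{*,0}(-A^{(2)}_{0,-1}-A^{(2)}_{1,-1}+A^{(2)}_{0,1}+A^{(2)}_{1,1})\mathbf 1+\boldsymbol\pi^{(2)}_{*,1}(I-R^{(2)}_* )^{-1}(-A_{*,-1}+A_{*,1})\mathbf 1$. Standing assumptions. (1) $\{\boldsymbol Y_n\}$ is irreducible and aperiodic. (2) $\{\tilde{\boldsymbol Y}_n\},\{\tilde{\boldsymbol Y}^{(1)}_n\},\{\tilde{\boldsymbol Y}^{(2)}_n\}$ are irreducible and aperiodic. (3) The rate matrices of $\{\boldsymbol Y_n\}$ viewed as a QBD process with level $X_{1,n}$ (resp. $X_{2,n}$)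 and countable phase $(X_{2,n},J_n)$ (resp. $(X_{1,n},J_n)$) are irreducible. (4) $a^{\{1,2\}}_1$ or $a^{\{1,2\}}_2$ is negative; if both are negative, then $a^{\{1\}}_1<0$ and $a^{\{2\}}_2<0$; if $a^{\{1,2\}}_1>0,a^{\{1,2\}}_2<0$, then $a^{\{1\}}_1<0$; if $a^{\{1,2\}}_1<0,a^{\{1,2\}}_2>0$, then $a^{\{2\}}_2<0$. The functions $\psi_1,\psi_2$. For $z>0$ let $A_{*,j}(z)=\sum_{i\in\mathbb{H}}A_{i,j}z^i$, $A_{i,*}(z)=\sum_{j\in\mathbb{H}}A_{i,j}z^j$ ($i,j\in\mathbb H$), $A^{(1)}_{*,i}(z)=\sum_{j\in\mathbb{H}}A^{(1)}_{j,i}z^j$, $A^{(2)}_{i,*}(z)=\sum_{j\in\mathbb{H}}A^{(2)}_{i,j}z^j$ ($i\in\mathbb{H}_+$). Let $C(z_1,z_2)=\sum_{i,j}A_{i,j}z_1^iz_2^j$, $\chi=\mathrm{spr}(C)$ (spectral radius), and let $\underline z_i^*=e^{\underline s_i^*}$, $\bar z_i^*=e^{\bar s_i^*}$, where $\underline s_i^*,\bar s_i^*$ are the minimum and maximum of $s_i$ over the compact set $\{(s_1,s_2)\in\mathbb{R}^2:\chi(e^{s_1},e^{s_2})\le1\}$. For $z\in[\underline z_1^*,\bar z_1^*]$, $G_1(z)$ is the minimal nonnegative solution of $A_{*,-1}(z)+A_{*,0}(z)X+A_{*,1}(z)X^2=X$; for $z\in[\underline z_2^*,\bar z_2^*]$,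 $G_2(z)$ is that of $A_{-1,*}(z)+A_{0,*}(z)X+A_{1,*}(z)X^2=X$ (these exist). Finally $\psi_1(z)=\mathrm{spr}\big(A^{(1)}_{*,0}(z)+A^{(1)}_{*,1}(z)G_1(z)\big)$ and $\psi_2(z)=\mathrm{spr}\big(A^{(2)}_{0,*}(z)+A^{(2)}_{1,*}(z)G_2(z)\big)$. *)

theory Defs
  imports "HOL-Analysis.Analysis"
begin

section \<open>Countable nonnegative matrices\<close>

text \<open>
  Countable matrices are functions into the extended nonnegative reals, so that products and powers
  are always defined; their order is the entrywise one.
\<close>

definition mmult :: "('s \<Rightarrow> 's \<Rightarrow> ennreal) \<Rightarrow> ('s \<Rightarrow> 's \<Rightarrow> ennreal) \<Rightarrow> 's \<Rightarrow> 's \<Rightarrow> ennreal" where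
  "mmult P Q x y = (\<Sum>\<^sub>\<infinity>z. P x z * Q z y)"

primrec mpow :: "('s \<Rightarrow> 's \<Rightarrow> ennreal) \<Rightarrow> nat \<Rightarrow> 's \<Rightarrow> 's \<Rightarrow> ennreal" where
  "mpow P 0 = (\<lambda>x y. if x = y then 1 else 0)"
| "mpow P (Suc n) = mmult (mpow P n) P"

text \<open>All index sets below are infinite, so admitting the exponent 0 here makes no difference.\<close>

definition irreducible_matrix :: "('s \<Rightarrow> 's \<Rightarrow> ennreal) \<Rightarrow> bool" where
  "irreducible_matrix P \<longleftrightarrow> (\<forall>x y. \<exists>n. 0 < mpow P n x y)"

definition irreducible_chain :: "('s \<Rightarrow> 's \<Rightarrow> real) \<Rightarrow> bool" where
  "irreducible_chain P \<longleftrightarrow> irreducible_matrix (\<lambda>x y. ennreal (P x y))"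

definition aperiodic_chain :: "('s \<Rightarrow> 's \<Rightarrow> real) \<Rightarrow> bool" where
  "aperiodic_chain P \<longleftrightarrow> (\<forall>x. Gcd {n. 0 < n \<and> 0 < mpow (\<lambda>x y. ennreal (P x y)) n x x} = 1)"

definition is_stationary_distribution :: "('s \<Rightarrow> 's \<Rightarrow> real) \<Rightarrow> ('s \<Rightarrow> real) \<Rightarrow> bool" where
  "is_stationary_distribution P p \<longleftrightarrow>
     (\<forall>x. 0 \<le> p x) \<and> (p has_sum 1) UNIV \<and> (\<forall>y. ((\<lambda>x. p x * P x y) has_sum p y) UNIV)"

definition stationary_distribution :: "('s \<Rightarrow> 's \<Rightarrow> real) \<Rightarrow> 's \<Rightarrow> real" where
  "stationary_distribution P = (THE p. is_stationary_distribution P p)"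

text \<open>
  The rate matrix of a QBD process with countably many phases whose transitions one level up,
  within a level and one level down are \<open>U\<close>, \<open>S\<close> and \<open>D\<close>: the minimal nonnegative solution of
  \<open>X = U + X S + X X D\<close>.
\<close>

definition rate_matrix ::
  "('s \<Rightarrow> 's \<Rightarrow> ennreal) \<Rightarrow> ('s \<Rightarrow> 's \<Rightarrow> ennreal) \<Rightarrow> ('s \<Rightarrow> 's \<Rightarrow> ennreal) \<Rightarrow> 's \<Rightarrow> 's \<Rightarrow> ennreal" where
  "rate_matrix U S D =
     (LEAST X. X = (\<lambda>x y. U x y + mmult X S x y + mmult (mmult X X) D x y))"


section \<open>Finite matrices\<close>

definition stochastic_matrix :: "real^'n^'n \<Rightarrow> bool" where
  "stochastic_matrix M \<longleftrightarrow> 0 \<le> M \<and> M *v 1 = 1"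

definition spr :: "real^'n^'n \<Rightarrow> real" where
  "spr M = Max {cmod l | l. \<exists>v::complex^'n. v \<noteq> 0 \<and>
                              (\<chi> i j. complex_of_real (M $ i $ j)) *v v = l *s v}"

text \<open>
  In the next two definitions the order is the entrywise one; \<open>U\<close>, \<open>S\<close> and \<open>D\<close> are again the
  blocks up, local and down.
\<close>

definition R_min :: "real^'n^'n \<Rightarrow> real^'n^'n \<Rightarrow> real^'n^'n \<Rightarrow> real^'n^'n" where
  "R_min U S D = (LEAST X. 0 \<le> X \<and> X = U + X ** S + X ** X ** D)"

definition G_min :: "real^'n^'n \<Rightarrow> real^'n^'n \<Rightarrow> real^'n^'n \<Rightarrow> real^'n^'n" where
  "G_min U S D = (LEAST X. 0 \<le> X \<and> D + S ** X + U ** X ** X = X)"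

text \<open>
  The block tridiagonal matrix with first block row \<open>(B0, B1, 0, \<dots>)\<close> and every other block row
  having \<open>D\<close>, \<open>S\<close>, \<open>U\<close> on the sub-, main and super-diagonal.
\<close>

fun block_tridiag ::
  "real^'n^'n \<Rightarrow> real^'n^'n \<Rightarrow> real^'n^'n \<Rightarrow> real^'n^'n \<Rightarrow> real^'n^'n \<Rightarrow> nat \<times> 'n \<Rightarrow> nat \<times> 'n \<Rightarrow> real" where
  "block_tridiag B0 B1 U S D (k, i) (l, j) =
     (if k = 0 then (if l = 0 then B0 else if l = 1 then B1 else 0)
      else if l + 1 = k then D else if l = k then S else if l = k + 1 then U else 0) $ i $ j"


section \<open>The two-dimensional QBD process and its induced chains\<close>

text \<open>
  The phase set is the finite type \<open>'n\<close>. A family of blocks is a function of two integer indices;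
  only its values at the admissible indices are used below.
\<close>

abbreviation HH :: "int set" where "HH \<equiv> {-1, 0, 1}"
abbreviation HHp :: "int set" where "HHp \<equiv> {0, 1}"

definition qbd_blocks ::
  "(int \<Rightarrow> int \<Rightarrow> real^'n^'n) \<Rightarrow> (int \<Rightarrow> int \<Rightarrow> real^'n^'n) \<Rightarrow> (int \<Rightarrow> int \<Rightarrow> real^'n^'n) \<Rightarrow>
   (int \<Rightarrow> int \<Rightarrow> real^'n^'n) \<Rightarrow> bool" where
  "qbd_blocks A A1 A2 A0 \<longleftrightarrow>
     (\<forall>i\<in>HH. \<forall>j\<in>HH. 0 \<le> A i j) \<and> (\<forall>i\<in>HH. \<forall>j\<in>HHp. 0 \<le> A1 i j) \<and>
     (\<forall>i\<in>HHp. \<forall>j\<in>HH. 0 \<le> A2 i j) \<and> (\<forall>i\<in>HHp. \<forall>j\<in>HHp. 0 \<le> A0 i j) \<and>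
     stochastic_matrix (\<Sum>i\<in>HH. \<Sum>j\<in>HH. A i j) \<and> stochastic_matrix (\<Sum>i\<in>HH. \<Sum>j\<in>HHp. A1 i j) \<and>
     stochastic_matrix (\<Sum>i\<in>HHp. \<Sum>j\<in>HH. A2 i j) \<and> stochastic_matrix (\<Sum>i\<in>HHp. \<Sum>j\<in>HHp. A0 i j)"

text \<open>
  Below, \<open>PY\<close>, \<open>PT\<close>, \<open>PT1\<close> and \<open>PT2\<close> are the transition matrices of \<open>Y\<close> and of the three chains
  written with a tilde. A jump from a boundary coordinate 0 is automatically nonnegative because
  that coordinate is a natural number.
\<close>

fun PY ::
  "(int \<Rightarrow> int \<Rightarrow> real^'n^'n) \<Rightarrow> (int \<Rightarrow> int \<Rightarrow> real^'n^'n) \<Rightarrow> (int \<Rightarrow> int \<Rightarrow> real^'n^'n) \<Rightarrow>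
   (int \<Rightarrow> int \<Rightarrow> real^'n^'n) \<Rightarrow> nat \<times> nat \<times> 'n \<Rightarrow> nat \<times> nat \<times> 'n \<Rightarrow> real" where
  "PY A A1 A2 A0 (x1, x2, j) (y1, y2, k) =
     (if int y1 - int x1 \<in> HH \<and> int y2 - int x2 \<in> HH
      then (if x1 \<noteq> 0 \<and> x2 \<noteq> 0 then A
            else if x1 \<noteq> 0 then A1
            else if x2 \<noteq> 0 then A2
            else A0) (int y1 - int x1) (int y2 - int x2) $ j $ k
      else 0)"

fun PT :: "(int \<Rightarrow> int \<Rightarrow> real^'n^'n) \<Rightarrow> int \<times> int \<times> 'n \<Rightarrow> int \<times> int \<times> 'n \<Rightarrow> real" where
  "PT A (x1, x2, j) (y1, y2, k) =
     (if y1 - x1 \<in> HH \<and> y2 - x2 \<in> HH then A (y1 - x1) (y2 - x2) $ j $ k else 0)"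

fun PT1 ::
  "(int \<Rightarrow> int \<Rightarrow> real^'n^'n) \<Rightarrow> (int \<Rightarrow> int \<Rightarrow> real^'n^'n) \<Rightarrow>
   int \<times> nat \<times> 'n \<Rightarrow> int \<times> nat \<times> 'n \<Rightarrow> real" where
  "PT1 A A1 (x1, x2, j) (y1, y2, k) =
     (if y1 - x1 \<in> HH \<and> int y2 - int x2 \<in> HH
      then (if x2 \<noteq> 0 then A else A1) (y1 - x1) (int y2 - int x2) $ j $ k
      else 0)"

fun PT2 ::
  "(int \<Rightarrow> int \<Rightarrow> real^'n^'n) \<Rightarrow> (int \<Rightarrow> int \<Rightarrow> real^'n^'n) \<Rightarrow>
   nat \<times> int \<times> 'n \<Rightarrow> nat \<times> int \<times> 'n \<Rightarrow> real" where
  "PT2 A A2 (x1, x2, j) (y1, y2, k) =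
     (if int y1 - int x1 \<in> HH \<and> y2 - x2 \<in> HH
      then (if x1 \<noteq> 0 then A else A2) (int y1 - int x1) (y2 - x2) $ j $ k
      else 0)"

text \<open>
  The rate matrices of \<open>Y\<close> as a QBD process with level \<open>X1\<close> (phase \<open>(X2, J)\<close>) and with level \<open>X2\<close>
  (phase \<open>(X1, J)\<close>). By homogeneity in the positive levels the blocks can be read off at level 1.
\<close>

definition rate_matrix1 ::
  "(int \<Rightarrow> int \<Rightarrow> real^'n^'n) \<Rightarrow> (int \<Rightarrow> int \<Rightarrow> real^'n^'n) \<Rightarrow> (int \<Rightarrow> int \<Rightarrow> real^'n^'n) \<Rightarrow>
   (int \<Rightarrow> int \<Rightarrow> real^'n^'n) \<Rightarrow> nat \<times> 'n \<Rightarrow> nat \<times> 'n \<Rightarrow> ennreal" where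
  "rate_matrix1 A A1 A2 A0 =
     (let Q = (\<lambda>l (x2, j) (y2, k). ennreal (PY A A1 A2 A0 (1, x2, j) (l, y2, k)))
      in rate_matrix (Q 2) (Q 1) (Q 0))"

definition rate_matrix2 ::
  "(int \<Rightarrow> int \<Rightarrow> real^'n^'n) \<Rightarrow> (int \<Rightarrow> int \<Rightarrow> real^'n^'n) \<Rightarrow> (int \<Rightarrow> int \<Rightarrow> real^'n^'n) \<Rightarrow>
   (int \<Rightarrow> int \<Rightarrow> real^'n^'n) \<Rightarrow> nat \<times> 'n \<Rightarrow> nat \<times> 'n \<Rightarrow> ennreal" where
  "rate_matrix2 A A1 A2 A0 =
     (let Q = (\<lambda>l (x1, j) (y1, k). ennreal (PY A A1 A2 A0 (x1, 1, j) (y1, l, k)))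
      in rate_matrix (Q 2) (Q 1) (Q 0))"


section \<open>Drifts\<close>

text \<open>
  \<open>row_sum A k\<close> and \<open>col_sum A k\<close> stand for \<open>A\<close> with indices \<open>(k, *)\<close> and \<open>(*, k)\<close>; they are
  also applied to the boundary blocks \<open>A2\<close> and \<open>A1\<close>, respectively.
\<close>

definition row_sum :: "(int \<Rightarrow> int \<Rightarrow> real^'n^'n) \<Rightarrow> int \<Rightarrow> real^'n^'n" where
  "row_sum A k = (\<Sum>l\<in>HH. A k l)"

definition col_sum :: "(int \<Rightarrow> int \<Rightarrow> real^'n^'n) \<Rightarrow> int \<Rightarrow> real^'n^'n" where
  "col_sum A k = (\<Sum>l\<in>HH. A l k)"

definition pi_inner :: "(int \<Rightarrow> int \<Rightarrow> real^'n^'n) \<Rightarrow> real^'n" where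
  "pi_inner A = (\<chi> j. stationary_distribution (\<lambda>i j. (\<Sum>k\<in>HH. \<Sum>l\<in>HH. A k l) $ i $ j) j)"

text \<open>The components of the drift \<open>a\<close> with superscript \<open>{1,2}\<close>.\<close>

definition a1_12 :: "(int \<Rightarrow> int \<Rightarrow> real^'n^'n) \<Rightarrow> real" where
  "a1_12 A = pi_inner A \<bullet> ((- row_sum A (-1) + row_sum A 1) *v 1)"

definition a2_12 :: "(int \<Rightarrow> int \<Rightarrow> real^'n^'n) \<Rightarrow> real" where
  "a2_12 A = pi_inner A \<bullet> ((- col_sum A (-1) + col_sum A 1) *v 1)"

definition pi1 :: "(int \<Rightarrow> int \<Rightarrow> real^'n^'n) \<Rightarrow> (int \<Rightarrow> int \<Rightarrow> real^'n^'n) \<Rightarrow> nat \<Rightarrow> real^'n" where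
  "pi1 A A1 k = (\<chi> j. stationary_distribution
     (block_tridiag (col_sum A1 0) (col_sum A1 1) (col_sum A 1) (col_sum A 0) (col_sum A (-1))) (k, j))"

definition pi2 :: "(int \<Rightarrow> int \<Rightarrow> real^'n^'n) \<Rightarrow> (int \<Rightarrow> int \<Rightarrow> real^'n^'n) \<Rightarrow> nat \<Rightarrow> real^'n" where
  "pi2 A A2 k = (\<chi> j. stationary_distribution
     (block_tridiag (row_sum A2 0) (row_sum A2 1) (row_sum A 1) (row_sum A 0) (row_sum A (-1))) (k, j))"

definition R1 :: "(int \<Rightarrow> int \<Rightarrow> real^'n^'n) \<Rightarrow> real^'n^'n" where
  "R1 A = R_min (col_sum A 1) (col_sum A 0) (col_sum A (-1))"

definition R2 :: "(int \<Rightarrow> int \<Rightarrow> real^'n^'n) \<Rightarrow> real^'n^'n" where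
  "R2 A = R_min (row_sum A 1) (row_sum A 0) (row_sum A (-1))"

text \<open>
  The drifts \<open>a1\<close> with superscript \<open>{1}\<close> and \<open>a2\<close> with superscript \<open>{2}\<close>. They are meaningful only
  when the stationary distribution concerned exists, i.e. if \<open>a2_12 A < 0\<close>, respectively
  \<open>a1_12 A < 0\<close>.
\<close>

definition a1_1 :: "(int \<Rightarrow> int \<Rightarrow> real^'n^'n) \<Rightarrow> (int \<Rightarrow> int \<Rightarrow> real^'n^'n) \<Rightarrow> real" where
  "a1_1 A A1 =
     pi1 A A1 0 \<bullet> ((- A1 (-1) 0 - A1 (-1) 1 + A1 1 0 + A1 1 1) *v 1) +
     (pi1 A A1 1 v* matrix_inv (mat 1 - R1 A)) \<bullet> ((- row_sum A (-1) + row_sum A 1) *v 1)"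

definition a2_2 :: "(int \<Rightarrow> int \<Rightarrow> real^'n^'n) \<Rightarrow> (int \<Rightarrow> int \<Rightarrow> real^'n^'n) \<Rightarrow> real" where
  "a2_2 A A2 =
     pi2 A A2 0 \<bullet> ((- A2 0 (-1) - A2 1 (-1) + A2 0 1 + A2 1 1) *v 1) +
     (pi2 A A2 1 v* matrix_inv (mat 1 - R2 A)) \<bullet> ((- col_sum A (-1) + col_sum A 1) *v 1)"

definition drift_condition ::
  "(int \<Rightarrow> int \<Rightarrow> real^'n^'n) \<Rightarrow> (int \<Rightarrow> int \<Rightarrow> real^'n^'n) \<Rightarrow> (int \<Rightarrow> int \<Rightarrow> real^'n^'n) \<Rightarrow> bool" where
  "drift_condition A A1 A2 \<longleftrightarrow>
     (a1_12 A < 0 \<or> a2_12 A < 0) \<and>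
     (a1_12 A < 0 \<and> a2_12 A < 0 \<longrightarrow> a1_1 A A1 < 0 \<and> a2_2 A A2 < 0) \<and>
     (a1_12 A > 0 \<and> a2_12 A < 0 \<longrightarrow> a1_1 A A1 < 0) \<and>
     (a1_12 A < 0 \<and> a2_12 A > 0 \<longrightarrow> a2_2 A A2 < 0)"


section \<open>The functions \<open>\<psi>\<^sub>1\<close> and \<open>\<psi>\<^sub>2\<close>\<close>

definition row_gf :: "(int \<Rightarrow> int \<Rightarrow> real^'n^'n) \<Rightarrow> int \<Rightarrow> real \<Rightarrow> real^'n^'n" where
  "row_gf A i z = (\<Sum>j\<in>HH. z powi j *\<^sub>R A i j)"

definition col_gf :: "(int \<Rightarrow> int \<Rightarrow> real^'n^'n) \<Rightarrow> int \<Rightarrow> real \<Rightarrow> real^'n^'n" where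
  "col_gf A j z = (\<Sum>i\<in>HH. z powi i *\<^sub>R A i j)"

text \<open>
  \<open>G1 A z\<close> is meaningful for \<open>z\<close> between \<open>exp s_min\<close> and \<open>exp s_max\<close>, where \<open>s_min\<close> and \<open>s_max\<close> are
  the extreme values of \<open>s1\<close> on the set of \<open>(s1, s2)\<close> at which the spectral radius of the sum of all
  \<open>exp (i * s1 + j * s2) *\<^sub>R A i j\<close> is at most 1; if \<open>a2_12 A < 0\<close>, the point \<open>z = 1\<close> is interior to
  this interval. The case of \<open>G2\<close> is symmetric. For other \<open>z\<close> the values carry no meaning.
\<close>

definition G1 :: "(int \<Rightarrow> int \<Rightarrow> real^'n^'n) \<Rightarrow> real \<Rightarrow> real^'n^'n" where
  "G1 A z = G_min (col_gf A 1 z) (col_gf A 0 z) (col_gf A (-1) z)"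

definition G2 :: "(int \<Rightarrow> int \<Rightarrow> real^'n^'n) \<Rightarrow> real \<Rightarrow> real^'n^'n" where
  "G2 A z = G_min (row_gf A 1 z) (row_gf A 0 z) (row_gf A (-1) z)"

definition psi1 :: "(int \<Rightarrow> int \<Rightarrow> real^'n^'n) \<Rightarrow> (int \<Rightarrow> int \<Rightarrow> real^'n^'n) \<Rightarrow> real \<Rightarrow> real" where
  "psi1 A A1 z = spr (col_gf A1 0 z + col_gf A1 1 z ** G1 A z)"

definition psi2 :: "(int \<Rightarrow> int \<Rightarrow> real^'n^'n) \<Rightarrow> (int \<Rightarrow> int \<Rightarrow> real^'n^'n) \<Rightarrow> real \<Rightarrow> real" where
  "psi2 A A2 z = spr (row_gf A2 0 z + row_gf A2 1 z ** G2 A z)"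

end

(* Sum out the first coordinate: D, S, U are the resulting blocks of the second coordinate (the level)
   for a step down, within the level and up, B0, B1 those at the boundary. Let K = B0 + B1 G be the
   transition matrix of the level process censored at level 0, and q its stationary distribution.
   Testing the Perron eigenvector equation of the perturbed matrix against q shows that the
   derivative of spr at z = 1 is q K'(1) 1. The derivative of G is obtained by
   differentiating the quadratic equation for G; applied to the vector of ones it satisfies
   (I - R)(I - S - U G) G'(1) 1 = d, where d is the vector of mean first-coordinate increments away
   from the boundary. Since the stationary distribution of the level process is matrix geometric with
   levels proportional to q, q B1 N, q B1 N R, ..., where N is the inverse of I - S - U G and R = U N,
   q K'(1) 1 is the drift up to the normalizing constant.
   All spectral conditions are obtained from one Lyapunov function x^k w that decays geometrically. *)

theory Submission
  imports Defs "HOL-Computational_Algebra.Polynomial"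
begin

section \<open>Entrywise ordered matrices\<close>

text \<open>Two objects resist routine differentiation. \<open>G_min\<close> is singled out by
  minimality: the implicit function theorem yields a smooth branch of solutions but does not place
  the minimal one on it. Order comparison with explicit supersolutions supplies a Lipschitz bound
  instead. \<open>spr\<close> is a maximum over complex eigenvalues, and for z other than 1 the
  censored matrix is only known to be nonnegative. Its Perron vector is therefore taken merely
  nonnegative; it converges to the vector of ones and so becomes strictly positive, which identifies
  its eigenvalue. What the Lyapunov function delivers is one fact: u = 0 is the only nonnegative u
  with u \<le> T u, where T = S + U + U G. It makes G stochastic, gives nonnegative inverses of I -
  S - U G and I - R, and makes the linearized equation for G invertible. The constant c_1 is the
  reciprocal of the stationary probability of level 0.\<close>

interpretation mmul: bounded_bilinear "(**) :: real^'n^'n \<Rightarrow> real^'n^'n \<Rightarrow> real^'n^'n"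
  unfolding bilinear_conv_bounded_bilinear[symmetric] bilinear_def linear_iff
  by (simp add: matrix_add_ldistrib matrix_scalar_ac scalar_matrix_assoc[symmetric])
     (simp add: vec_eq_iff matrix_matrix_mult_def sum.distrib distrib_right)

interpretation mvec: bounded_bilinear "(*v) :: real^'n^'n \<Rightarrow> real^'n \<Rightarrow> real^'n"
  unfolding bilinear_conv_bounded_bilinear[symmetric] bilinear_def linear_iff
  by (simp add: matrix_vector_right_distrib matrix_vector_mult_add_rdistrib matrix_vector_mult_scaleR)
     (simp add: vec_eq_iff matrix_vector_mult_def sum_distrib_left mult.assoc)

lemmas matrix_algebra =
  mmul.add_left mmul.add_right mmul.diff_left mmul.diff_right mmul.scaleR_left mmul.scaleR_right
  mmul.minus_left mmul.minus_right
  mvec.add_left mvec.add_right mvec.diff_left mvec.diff_right mvec.scaleR_left mvec.scaleR_right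
  mvec.minus_left mvec.minus_right
  matrix_mul_assoc[symmetric] matrix_vector_mul_assoc[symmetric]

lemma matrix_le_iff: "A \<le> (B::real^'n^'m) \<longleftrightarrow> (\<forall>i j. A$i$j \<le> B$i$j)"
  by (simp add: less_eq_vec_def)

lemma vec_le_iff: "x \<le> (y::real^'n) \<longleftrightarrow> (\<forall>i. x$i \<le> y$i)"
  by (simp add: less_eq_vec_def)

lemma mvec_mono: "0 \<le> (A::real^'n^'n) \<Longrightarrow> x \<le> y \<Longrightarrow> A *v x \<le> A *v y"
  by (auto simp: vec_le_iff matrix_le_iff matrix_vector_mult_def intro!: sum_mono mult_left_mono)

lemma mvec_mono_left: "(A::real^'n^'n) \<le> B \<Longrightarrow> 0 \<le> x \<Longrightarrow> A *v x \<le> B *v x"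
  by (auto simp: vec_le_iff matrix_le_iff matrix_vector_mult_def intro!: sum_mono mult_right_mono)

lemma mvec_nonneg: "0 \<le> (A::real^'n^'n) \<Longrightarrow> 0 \<le> x \<Longrightarrow> 0 \<le> A *v x"
  using mvec_mono[of A 0 x] by simp

lemma mmul_mono: "0 \<le> (A::real^'n^'n) \<Longrightarrow> X \<le> Y \<Longrightarrow> A ** X \<le> A ** Y"
  by (auto simp: matrix_le_iff matrix_matrix_mult_def intro!: sum_mono mult_left_mono)

lemma mmul_mono_left: "(A::real^'n^'n) \<le> B \<Longrightarrow> 0 \<le> X \<Longrightarrow> A ** X \<le> B ** X"
  by (auto simp: matrix_le_iff matrix_matrix_mult_def intro!: sum_mono mult_right_mono)

lemma mmul_nonneg: "0 \<le> (A::real^'n^'n) \<Longrightarrow> 0 \<le> X \<Longrightarrow> 0 \<le> A ** X"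
  using mmul_mono[of A 0 X] by simp

lemma mmul_mono_both: "0 \<le> (A::real^'n^'n) \<Longrightarrow> A \<le> B \<Longrightarrow> 0 \<le> X \<Longrightarrow> X \<le> Y \<Longrightarrow> A ** X \<le> B ** Y"
  by (meson mmul_mono mmul_mono_left order_trans)

lemma vecm_nonneg: "0 \<le> (A::real^'n^'n) \<Longrightarrow> 0 \<le> x \<Longrightarrow> 0 \<le> x v* A"
  by (auto simp: vec_le_iff matrix_le_iff vector_matrix_mult_def intro!: sum_nonneg)

lemma vec_ge_0D: "0 \<le> (x::real^'n) \<Longrightarrow> 0 \<le> x $ i"
  by (simp add: vec_le_iff)

lemma mat_ge_0D: "0 \<le> (A::real^'n^'m) \<Longrightarrow> 0 \<le> A $ i $ j"
  by (simp add: matrix_le_iff)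

lemma mat_1_nonneg: "0 \<le> (mat 1 :: real^'n^'n)"
  by (simp add: matrix_le_iff mat_def)

lemma inner_nonneg: "0 \<le> (x::real^'n) \<Longrightarrow> 0 \<le> y \<Longrightarrow> 0 \<le> x \<bullet> y"
  by (auto simp: inner_vec_def vec_le_iff intro!: sum_nonneg)

lemma inner_1: "x \<bullet> (1::real^'n) = (\<Sum>i\<in>UNIV. x $ i)"
  by (simp add: inner_vec_def)

text \<open>Here \<open>1\<close> is the matrix with all entries 1; the identity is
  \<open>mat 1\<close>. With \<open>mat_norm_bound\<close> this translates between the entrywise
  order, in which minimality is stated, and the norm needed for limits.\<close>

lemma mat_norm_le: "(A::real^'n^'n) \<le> norm A *\<^sub>R 1"
proof -
  have "A$i$j \<le> norm A" for i j
    using component_le_norm_cart[of "A$i" j] Finite_Cartesian_Product.norm_nth_le[of A i] by linarith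
  thus ?thesis by (simp add: matrix_le_iff)
qed

lemma mat_norm_bound:
  assumes "- B \<le> A" "A \<le> (B::real^'n^'n)"
  shows "norm A \<le> norm B"
proof -
  have "norm (A$i) \<le> norm (B$i)" for i
  proof (rule norm_le_componentwise_cart)
    fix j
    have "- B$i$j \<le> A$i$j" "A$i$j \<le> B$i$j" using assms by (auto simp: matrix_le_iff)
    thus "norm (A$i$j) \<le> norm (B$i$j)" by simp
  qed
  thus ?thesis unfolding norm_vec_def[of A] norm_vec_def[of B] by (intro L2_set_mono) auto
qed

lemma mat_norm_mono: "0 \<le> (A::real^'n^'n) \<Longrightarrow> A \<le> B \<Longrightarrow> norm A \<le> norm B"
  by (rule mat_norm_bound) (auto intro: order_trans[of _ 0] order_trans[of 0 A])

lemma finite_uniform_bound: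
  fixes f :: "'n::finite \<Rightarrow> real"
  obtains c where "0 < c" "\<And>i. \<bar>f i\<bar> \<le> c"
proof (rule that)
  have le: "\<bar>f i\<bar> \<le> (MAX i. \<bar>f i\<bar>)" for i by (rule Max_ge) auto
  show "0 < (MAX i. \<bar>f i\<bar>) + 1" using le[of undefined] by linarith
  show "\<bar>f i\<bar> \<le> (MAX i. \<bar>f i\<bar>) + 1" for i using le[of i] by linarith
qed

section \<open>Nonnegative inverses and least fixed points\<close>

lemma injective_imp_inverse:
  fixes M :: "real^'n^'n"
  assumes "\<And>x. M *v x = 0 \<Longrightarrow> x = 0"
  obtains B where "B ** M = mat 1" "M ** B = mat 1"
  by (metis assms matrix_left_invertible_ker matrix_left_right_inverse)

lemma matrix_inv_eqI:
  fixes M :: "real^'n^'n"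
  assumes "B ** M = mat 1" "M ** B = mat 1"
  shows "matrix_inv M = B"
proof -
  have "\<exists>A'. M ** A' = mat 1 \<and> A' ** M = mat 1" using assms by blast
  hence "M ** matrix_inv M = mat 1 \<and> matrix_inv M ** M = mat 1"
    unfolding matrix_inv_def by (rule someI_ex)
  thus ?thesis by (metis assms(1) matrix_mul_assoc matrix_mul_lid matrix_mul_rid)
qed

text \<open>The property of \<open>M\<close> assumed here says that its spectral radius is less than 1.\<close>

lemma nonneg_inverse:
  fixes M :: "real^'n^'n"
  assumes M: "0 \<le> M" and conv: "\<And>u. 0 \<le> u \<Longrightarrow> u \<le> M *v u \<Longrightarrow> u = 0"
  obtains N where "0 \<le> N" "N ** (mat 1 - M) = mat 1" "(mat 1 - M) ** N = mat 1"
proof -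
  \<comment> \<open>The negative part \<open>y\<close> of \<open>x\<close> satisfies
    \<open>y \<le> M *v y\<close> and therefore vanishes. Applied to \<open>x\<close> and
    \<open>- x\<close> this gives injectivity, applied to the columns of the inverse their
    nonnegativity.\<close>
  have inv_pos: "0 \<le> x" if x: "0 \<le> (mat 1 - M) *v x" for x
  proof -
    define y where "y = (\<chi> i. max (- x$i) 0)"
    have y: "0 \<le> y" "- x \<le> y" by (auto simp: y_def vec_le_iff)
    have "- x \<le> M *v (- x)" using x by (simp add: matrix_algebra)
    also have "\<dots> \<le> M *v y" by (rule mvec_mono[OF M y(2)])
    finally have "y \<le> M *v y"
      using mvec_nonneg[OF M y(1)] by (auto simp: y_def vec_le_iff)
    from conv[OF y(1) this] y(2) show ?thesis by (auto simp: vec_le_iff)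
  qed
  have "x = 0" if "(mat 1 - M) *v x = 0" for x
    using inv_pos[of x] inv_pos[of "- x"] that by (simp add: matrix_algebra vec_le_iff vec_eq_iff order_antisym)
  then obtain N where N: "N ** (mat 1 - M) = mat 1" "(mat 1 - M) ** N = mat 1"
    by (rule injective_imp_inverse)
  have "0 \<le> N $ i $ j" for i j
  proof -
    have "(mat 1 - M) *v (N *v axis j 1) = axis j 1"
      unfolding matrix_vector_mul_assoc N by (rule matrix_vector_mul_lid)
    moreover have "0 \<le> (axis j 1 :: real^'n)" by (simp add: vec_le_iff axis_def)
    ultimately have "0 \<le> (mat 1 - M) *v (N *v axis j 1)" by (simp only:)
    hence "0 \<le> N *v axis j 1" by (rule inv_pos)
    thus ?thesis unfolding matrix_vector_mult_basis column_def vec_le_iff by simp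
  qed
  hence "0 \<le> N" by (simp add: matrix_le_iff)
  with N show ?thesis using that by blast
qed

text \<open>Knaster-Tarski in an order that is only conditionally complete: \<open>Z\<close> makes
  the set of supersolutions nonempty, so that its infimum is meaningful. Leastness among all
  supersolutions, not only fixed points, is what the comparison arguments use.\<close>

lemma least_fixed_point:
  fixes F :: "real^'n^'n \<Rightarrow> real^'n^'n"
  assumes nonneg: "\<And>X. 0 \<le> X \<Longrightarrow> 0 \<le> F X"
    and mono: "\<And>X Y. 0 \<le> X \<Longrightarrow> X \<le> Y \<Longrightarrow> F X \<le> F Y"
    and Z: "0 \<le> Z" "F Z \<le> Z"
  defines "L \<equiv> (LEAST X. 0 \<le> X \<and> F X = X)"
  shows "0 \<le> L" "F L = L" "\<And>X. 0 \<le> X \<Longrightarrow> F X \<le> X \<Longrightarrow> L \<le> X"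
proof -
  define W where "W = {X. 0 \<le> X \<and> F X \<le> X}"
  define I where "I = Inf W"
  have bdd: "bdd_below W" by (rule bdd_belowI[of _ 0]) (simp add: W_def)
  have ZW: "Z \<in> W" using Z by (simp add: W_def)
  have lower: "I \<le> X" if "X \<in> W" for X
    unfolding I_def by (rule cInf_lower[OF that bdd])
  have I0: "0 \<le> I"
    unfolding I_def by (rule cInf_greatest) (use ZW in \<open>auto simp: W_def\<close>)
  have FI: "F I \<le> I"
    unfolding I_def
  proof (rule cInf_greatest)
    show "W \<noteq> {}" using ZW by auto
    fix X assume X: "X \<in> W"
    have "F I \<le> F X" by (rule mono[OF I0 lower[OF X]])
    also have "\<dots> \<le> X" using X by (simp add: W_def)
    finally show "F (Inf W) \<le> X" by (simp add: I_def)
  qed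
  have "F I \<in> W" using nonneg[OF I0] mono[OF nonneg[OF I0] FI] by (simp add: W_def)
  hence eq: "F I = I" using FI lower by (simp add: order_antisym)
  have "L = I" unfolding L_def
    by (rule Least_equality) (use I0 eq lower in \<open>auto simp: W_def\<close>)
  thus "0 \<le> L" "F L = L" "\<And>X. 0 \<le> X \<Longrightarrow> F X \<le> X \<Longrightarrow> L \<le> X"
    using I0 eq lower by (auto simp: W_def)
qed

section \<open>Stochastic matrices\<close>

text \<open>A real left eigenvector exists since \<open>mat 1 - Q\<close> is singular; its absolute value is
  subinvariant, hence invariant because \<open>Q\<close> preserves total mass.\<close>

lemma stochastic_left_eigenvector:
  fixes Q :: "real^'n^'n"
  assumes Q: "0 \<le> Q" "Q *v 1 = 1"
  obtains q where "0 \<le> q" "q \<bullet> 1 = 1" "q v* Q = q"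
proof -
  have "\<not> (\<exists>B. transpose (mat 1 - Q) ** B = mat 1)"
  proof
    assume "\<exists>B. transpose (mat 1 - Q) ** B = mat 1"
    then obtain B where "transpose B ** (mat 1 - Q) = mat 1"
      by (metis matrix_transpose_mul transpose_transpose transpose_mat)
    hence "transpose B *v ((mat 1 - Q) *v 1) = 1" by (simp add: matrix_vector_mul_assoc)
    thus False using Q by (simp add: matrix_algebra vec_eq_iff)
  qed
  hence "\<not> (\<exists>B. B ** transpose (mat 1 - Q) = mat 1)" by (metis matrix_left_right_inverse)
  then obtain r where r: "r \<noteq> 0" "transpose (mat 1 - Q) *v r = 0"
    by (metis matrix_left_invertible_ker)
  hence rQ: "r v* Q = r" by (simp add: vector_matrix_mult_diff_rdistrib)
  define s where "s = (\<chi> i. \<bar>r $ i\<bar>)"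
  have s0: "0 \<le> s" by (simp add: s_def vec_le_iff)
  have le: "s $ j \<le> (s v* Q) $ j" for j
  proof -
    have "r $ j = (\<Sum>i\<in>UNIV. r$i * Q$i$j)"
      by (subst rQ[symmetric]) (simp add: vector_matrix_mult_def)
    also have "\<bar>\<dots>\<bar> \<le> (\<Sum>i\<in>UNIV. \<bar>r$i * Q$i$j\<bar>)" by (rule sum_abs)
    finally show ?thesis
      using Q(1) by (simp add: s_def vector_matrix_mult_def abs_mult matrix_le_iff)
  qed
  have "(s v* Q - s) \<bullet> 1 = 0"
    by (simp add: inner_diff_left dot_lmul_matrix Q)
  hence "(\<Sum>i\<in>UNIV. (s v* Q - s) $ i) = 0" by (simp only: inner_1)
  hence "(s v* Q - s) $ i = 0" for i
    using le by (subst (asm) sum_nonneg_eq_0_iff) auto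
  hence sQ: "s v* Q = s" by (simp add: vec_eq_iff)
  have "s \<noteq> 0" using r by (auto simp: s_def vec_eq_iff)
  hence pos: "0 < s \<bullet> 1"
    using inner_nonneg[OF s0, of 1] s0 by (auto simp: inner_1 vec_le_iff vec_eq_iff less_le sum_nonneg_eq_0_iff)
  show ?thesis
  proof (rule that[of "(1 / (s \<bullet> 1)) *\<^sub>R s"])
    show "0 \<le> (1 / (s \<bullet> 1)) *\<^sub>R s" using pos s0 by (auto simp: vec_le_iff)
  qed (use pos sQ in \<open>auto simp: scaleR_vector_matrix_assoc\<close>)
qed

text \<open>\<open>mat 1 - Q\<close> kills the constants; adding the matrix with all rows
  \<open>q\<close> makes it invertible. The inverse is the fundamental matrix of the chain: it
  solves Poisson equations and controls vectors that are nearly fixed by \<open>Q\<close>.\<close>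

lemma rank_one_correction_inverse:
  fixes Q :: "real^'n^'n"
  assumes q: "q \<bullet> 1 = 1" "q v* Q = q" and Q1: "Q *v 1 = 1"
    and const: "\<And>r. Q *v r = r \<Longrightarrow> \<exists>c. r = c *\<^sub>R 1"
  obtains B :: "real^'n^'n" where "\<And>x. B *v (x - Q *v x + (q \<bullet> x) *\<^sub>R 1) = x"
    "\<And>x. (B *v x) - Q *v (B *v x) + (q \<bullet> (B *v x)) *\<^sub>R 1 = x"
proof -
  define M where "M = mat 1 - Q + (\<chi> i j. q $ j)"
  have M: "M *v x = x - Q *v x + (q \<bullet> x) *\<^sub>R 1" for x
  proof -
    have "(\<chi> i j. q $ j) *v x = (q \<bullet> x) *\<^sub>R 1"
      by (simp add: vec_eq_iff matrix_vector_mult_def inner_vec_def)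
    thus ?thesis by (simp add: M_def matrix_algebra)
  qed
  have "x = 0" if "M *v x = 0" for x
  proof -
    have "q \<bullet> (M *v x) = q \<bullet> x"
      by (simp add: M inner_add_right inner_diff_right q dot_lmul_matrix[symmetric])
    hence qx: "q \<bullet> x = 0" using that by simp
    hence "Q *v x = x" using that by (simp add: M)
    then obtain c where "x = c *\<^sub>R 1" using const by blast
    thus ?thesis using qx q by simp
  qed
  then obtain B where "B ** M = mat 1" "M ** B = mat 1" by (rule injective_imp_inverse)
  hence "B *v (M *v x) = x" "M *v (B *v x) = x" for x by (simp_all add: matrix_vector_mul_assoc)
  hence "B *v (x - Q *v x + (q \<bullet> x) *\<^sub>R 1) = x"
    "(B *v x) - Q *v (B *v x) + (q \<bullet> (B *v x)) *\<^sub>R 1 = x" for x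
    unfolding M by blast+
  thus ?thesis by (rule that)
qed

section \<open>Level transitions with downward drift\<close>

text \<open>\<open>x ^ k * w $ i\<close> is a Lyapunov function with geometric decay for the level process above level 0.\<close>

locale downward_qbd =
  fixes D S U :: "real^'n^'n" and x \<rho> :: real and w :: "real^'n"
  assumes D: "0 \<le> D" and S: "0 \<le> S" and U: "0 \<le> U" and row: "(D + S + U) *v 1 = 1"
    and x: "1 < x" and \<rho>: "0 < \<rho>" "\<rho> < 1" and w: "\<And>i. 0 < w $ i"
    and lyapunov: "D *v w + x *\<^sub>R (S *v w) + x\<^sup>2 *\<^sub>R (U *v w) \<le> (\<rho> * x) *\<^sub>R w"
begin

definition "G = G_min U S D"

text \<open>A bound on row sums gives no supersolution in the entrywise order. Brouwer's theorem on
  the substochastic matrices, which the quadratic map preserves because D + S + U has row sums 1,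
  supplies a solution; the least solution lies below it and inherits the row sum bound.\<close>

lemma
  shows G_nonneg: "0 \<le> G" and G_eq: "D + S ** G + U ** (G ** G) = G"
    and G_sub: "G *v 1 \<le> 1"
    and G_least: "\<And>X. 0 \<le> X \<Longrightarrow> D + S ** X + U ** (X ** X) \<le> X \<Longrightarrow> G \<le> X"
proof -
  let ?F = "\<lambda>X. D + S ** X + U ** (X ** X)"
  have Gdef: "G = (LEAST X. 0 \<le> X \<and> ?F X = X)"
    by (simp add: G_def G_min_def matrix_mul_assoc)
  have nn: "0 \<le> ?F X" if "0 \<le> X" for X
    by (intro add_nonneg_nonneg mmul_nonneg D S U that)
  have mono: "?F X \<le> ?F Y" if "0 \<le> X" "X \<le> Y" for X Y
    by (intro add_mono mmul_mono order_refl S U that mmul_mono_both)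
  define K where "K = {X::real^'n^'n. 0 \<le> X \<and> X *v 1 \<le> 1}"
  have K_le: "X \<le> 1" if "X \<in> K" for X
  proof -
    have "X $ i $ j \<le> 1" for i j
    proof -
      have "X $ i $ j \<le> (\<Sum>j\<in>UNIV. X $ i $ j)"
        by (rule member_le_sum) (use that in \<open>auto simp: K_def matrix_le_iff\<close>)
      also have "\<dots> \<le> 1" using that by (auto simp: K_def vec_le_iff matrix_vector_mult_def)
      finally show ?thesis .
    qed
    thus ?thesis by (simp add: matrix_le_iff)
  qed
  obtain Z where ZK: "Z \<in> K" and FZ: "?F Z = Z"
  proof (rule brouwer[of K ?F])
    have "norm X \<le> norm (1::real^'n^'n)" if "X \<in> K" for X
      by (rule mat_norm_mono[OF _ K_le[OF that]]) (use that in \<open>simp add: K_def\<close>)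
    hence "bounded K" unfolding bounded_iff by blast
    moreover have "closed K"
      unfolding K_def vec_le_iff matrix_le_iff matrix_vector_mult_def
      by (simp, intro closed_Collect_conj closed_Collect_all closed_Collect_le continuous_intros)
    ultimately show "compact K" by (simp add: compact_eq_bounded_closed)
    show "convex K"
    proof (rule convexI)
      fix X Y and u v :: real
      assume XY: "X \<in> K" "Y \<in> K" and uv: "0 \<le> u" "0 \<le> v" "u + v = 1"
      have "0 \<le> u *\<^sub>R X + v *\<^sub>R Y"
        using XY uv by (intro add_nonneg_nonneg scaleR_nonneg_nonneg) (auto simp: K_def)
      moreover have "u *\<^sub>R (X *v 1) + v *\<^sub>R (Y *v 1) \<le> u *\<^sub>R 1 + v *\<^sub>R 1"
        using XY uv by (intro add_mono scaleR_left_mono) (auto simp: K_def)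
      ultimately show "u *\<^sub>R X + v *\<^sub>R Y \<in> K"
        using uv by (simp add: K_def matrix_algebra scaleR_add_left[symmetric])
    qed
    have "0 \<in> K" by (simp add: K_def vec_le_iff)
    thus "K \<noteq> {}" by auto
    show "continuous_on K ?F" by (intro continuous_intros mmul.continuous_on)
    show "?F \<in> K \<rightarrow> K"
    proof
      fix X assume "X \<in> K"
      hence X: "0 \<le> X" "X *v 1 \<le> 1" by (simp_all add: K_def)
      have 1: "S *v (X *v 1) \<le> S *v 1" by (intro mvec_mono S X)
      have "X *v (X *v 1) \<le> X *v 1" by (intro mvec_mono X)
      hence 2: "U *v (X *v (X *v 1)) \<le> U *v 1" using X(2) by (intro mvec_mono U) (rule order_trans)
      have "?F X *v 1 = D *v 1 + S *v (X *v 1) + U *v (X *v (X *v 1))"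
        by (simp add: matrix_algebra)
      also have "\<dots> \<le> D *v 1 + S *v 1 + U *v 1" using 1 2 by (intro add_mono order_refl)
      also have "\<dots> = 1" using row by (simp add: matrix_algebra)
      finally show "?F X \<in> K" using nn[OF X(1)] by (simp add: K_def)
    qed
  qed
  have Z0: "0 \<le> Z" and Z1: "Z *v 1 \<le> 1" using ZK by (simp_all add: K_def)
  note L = least_fixed_point[of ?F Z, folded Gdef]
  show "0 \<le> G" by (rule L(1); fact nn mono Z0 eq_refl[OF FZ])
  show "?F G = G" by (rule L(2); fact nn mono Z0 eq_refl[OF FZ])
  show least: "G \<le> X" if "0 \<le> X" "?F X \<le> X" for X
    by (rule L(3); fact nn mono Z0 eq_refl[OF FZ] that)
  have "G \<le> Z" by (rule least[OF Z0 eq_refl[OF FZ]])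
  hence "G *v 1 \<le> Z *v 1" by (rule mvec_mono_left) (simp add: vec_le_iff)
  thus "G *v 1 \<le> 1" using Z1 by (rule order_trans)
qed

text \<open>\<open>V\<close> governs successive visits to a level before the process goes below it.
  \<open>T\<close> is the linearized equation for \<open>G\<close> seen on row sums: once
  \<open>G\<close> fixes the constants, \<open>V ** X + U ** (X ** G)\<close> has row sums
  \<open>T *v (X *v 1)\<close>.\<close>

definition "V = S + U ** G"
definition "T = V + U"

lemma V_nonneg: "0 \<le> V" and T_nonneg: "0 \<le> T"
  unfolding V_def T_def by (intro add_nonneg_nonneg mmul_nonneg S U G_nonneg)+

lemma T_mult: "T *v u = S *v u + U *v u + U *v (G *v u)"
  by (simp add: T_def V_def matrix_algebra)

text \<open>The vectors \<open>s k = (\<Sum>j<k. G ^ j) u\<close> grow at most linearly in \<open>k\<close>, and \<open>u \<le> T u\<close> makes them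
  a subharmonic function of the level process; comparison with the Lyapunov function gives \<open>u = 0\<close>.\<close>

lemma T_convergent:
  assumes u: "0 \<le> u" "u \<le> T *v u"
  shows "u = 0"
proof -
  define s where "s = rec_nat 0 (\<lambda>_ y. u + G *v y)"
  have s0: "s 0 = 0" and sS: "s (Suc k) = u + G *v s k" for k by (simp_all add: s_def)
  obtain c where c: "0 < c" "\<And>i. \<bar>u $ i\<bar> \<le> c" using finite_uniform_bound[of "\<lambda>i. u $ i"] by blast
  have uc: "u \<le> c *\<^sub>R 1" using c by (auto simp: vec_le_iff abs_le_iff)
  have sc: "s k \<le> (real k * c) *\<^sub>R 1" for k
  proof (induction k)
    case 0 thus ?case by (simp add: s0)
  next
    case (Suc k)
    have "G *v s k \<le> G *v ((real k * c) *\<^sub>R 1)" by (intro mvec_mono G_nonneg Suc)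
    also have "\<dots> = (real k * c) *\<^sub>R (G *v 1)" by (simp add: matrix_algebra)
    also have "\<dots> \<le> (real k * c) *\<^sub>R 1" using G_sub c by (intro scaleR_left_mono) auto
    finally have "s (Suc k) \<le> c *\<^sub>R 1 + (real k * c) *\<^sub>R 1"
      unfolding sS using uc by (intro add_mono)
    thus ?case by (simp add: algebra_simps)
  qed
  have sub: "s (Suc k) \<le> D *v s k + S *v s (Suc k) + U *v s (Suc (Suc k))" for k
  proof -
    have "D *v s k + S *v s (Suc k) + U *v s (Suc (Suc k)) = T *v u + (D + S ** G + U ** (G ** G)) *v s k"
      by (simp add: sS T_mult matrix_algebra algebra_simps)
    also have "\<dots> = T *v u + G *v s k" by (simp add: G_eq)
    finally show ?thesis using u by (simp add: sS)
  qed
  obtain e where e: "0 < e" "\<And>i. \<bar>1 / w $ i\<bar> \<le> e" using finite_uniform_bound[of "\<lambda>i. 1 / w $ i"] by blast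
  have ew: "1 \<le> e * w $ i" for i using e(2)[of i] w[of i] by (simp add: field_simps)
  define C where "C = c * e / (x - 1)"
  have C0: "0 < C" using c e x by (simp add: C_def)
  have "s k \<le> (C * \<rho> ^ n * x ^ k) *\<^sub>R w" for n k
  proof (induction n arbitrary: k)
    case 0
    have "1 + real k * (x - 1) \<le> (1 + (x - 1)) ^ k" by (rule Bernoulli_inequality) (use x in auto)
    hence "real k * (x - 1) \<le> x ^ k" by simp
    hence "real k \<le> x ^ k / (x - 1)" using x by (simp add: pos_le_divide_eq)
    hence "real k * c \<le> x ^ k / (x - 1) * c" using c by (intro mult_right_mono) auto
    have "s k $ i \<le> C * x ^ k * w $ i" for i
    proof -
      have "s k $ i \<le> real k * c" using sc[of k] by (simp add: vec_le_iff)
      also have "\<dots> \<le> x ^ k / (x - 1) * c" by fact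
      also have "\<dots> \<le> x ^ k / (x - 1) * c * (e * w $ i)"
        using mult_left_mono[OF ew[of i], of "x ^ k / (x - 1) * c"] x c by simp
      finally show ?thesis by (simp add: C_def mult_ac)
    qed
    thus ?case by (simp add: vec_le_iff)
  next
    case (Suc n)
    show ?case
    proof (cases k)
      case 0
      have "0 \<le> w" using w by (auto simp: vec_le_iff intro: less_imp_le)
      thus ?thesis using C0 \<rho> x 0 by (auto simp: s0 intro!: scaleR_nonneg_nonneg)
    next
      case (Suc l)
      let ?b = "C * \<rho> ^ n * x ^ l"
      have b: "0 \<le> ?b" using C0 \<rho> x by simp
      have "s (Suc l) \<le> D *v s l + S *v s (Suc l) + U *v s (Suc (Suc l))" by (rule sub)
      also have "\<dots> \<le> D *v (?b *\<^sub>R w) + S *v ((?b * x) *\<^sub>R w) + U *v ((?b * x\<^sup>2) *\<^sub>R w)"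
        using Suc.IH[of l] Suc.IH[of "Suc l"] Suc.IH[of "Suc (Suc l)"]
        by (intro add_mono mvec_mono D S U) (simp_all add: power2_eq_square mult_ac)
      also have "\<dots> = ?b *\<^sub>R (D *v w + x *\<^sub>R (S *v w) + x\<^sup>2 *\<^sub>R (U *v w))"
        by (simp add: matrix_algebra scaleR_add_right)
      also have "\<dots> \<le> ?b *\<^sub>R ((\<rho> * x) *\<^sub>R w)" by (rule scaleR_left_mono[OF lyapunov b])
      finally show ?thesis by (simp add: Suc mult_ac)
    qed
  qed
  from this[of 1] have "u \<le> (C * \<rho> ^ n * x) *\<^sub>R w" for n by (simp add: sS s0)
  hence ui: "u $ i \<le> C * \<rho> ^ n * x * w $ i" for i n by (simp add: vec_le_iff)
  have "u $ i \<le> 0" for i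
  proof (rule tendsto_lowerbound)
    show "(\<lambda>n. C * \<rho> ^ n * x * w $ i) \<longlonglongrightarrow> 0"
      using LIMSEQ_realpow_zero[of \<rho>] \<rho> by (intro tendsto_eq_intros) auto
  qed (use ui in auto)
  thus ?thesis using u by (simp add: vec_le_iff vec_eq_iff order_antisym)
qed

lemma V_convergent: "0 \<le> u \<Longrightarrow> u \<le> V *v u \<Longrightarrow> u = 0"
  using T_convergent mvec_nonneg[OF U] by (simp add: T_def matrix_algebra add_increasing2)

text \<open>The defect \<open>1 - G *v 1\<close> is a nonnegative fixed vector of \<open>T\<close>
  and hence vanishes. Under downward drift the next lower level is reached almost surely.\<close>

lemma G_stochastic: "G *v 1 = 1"
proof -
  have "1 - G *v 1 = T *v (1 - G *v 1)"
  proof -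
    have "(D + S ** G + U ** (G ** G)) *v 1 = G *v 1" by (simp add: G_eq)
    hence 1: "D *v 1 + S *v (G *v 1) + U *v (G *v (G *v 1)) = G *v 1" by (simp add: matrix_algebra)
    have 2: "D *v 1 + S *v 1 + U *v 1 = 1" using row by (simp add: matrix_algebra)
    have "T *v (1 - G *v 1) = S *v 1 + U *v 1 - S *v (G *v 1) - U *v (G *v (G *v 1))"
      by (simp add: T_mult matrix_algebra algebra_simps)
    also have "\<dots> = (D *v 1 + S *v 1 + U *v 1) - (D *v 1 + S *v (G *v 1) + U *v (G *v (G *v 1)))"
      by (simp add: algebra_simps)
    also have "\<dots> = 1 - G *v 1" by (simp only: 1 2)
    finally show ?thesis by simp
  qed
  moreover have "0 \<le> 1 - G *v 1" using G_sub by simp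
  ultimately have "1 - G *v 1 = 0" by (intro T_convergent) auto
  thus ?thesis by simp
qed

text \<open>The Neumann series of \<open>V\<close>: expected visits to the phases of a level before
  the process goes below it.\<close>

definition "N = (SOME N. 0 \<le> N \<and> N ** (mat 1 - V) = mat 1 \<and> (mat 1 - V) ** N = mat 1)"

lemma N_nonneg: "0 \<le> N" and N_left: "N ** (mat 1 - V) = mat 1" and N_right: "(mat 1 - V) ** N = mat 1"
proof -
  obtain M where "0 \<le> M" "M ** (mat 1 - V) = mat 1" "(mat 1 - V) ** M = mat 1"
    by (rule nonneg_inverse[OF V_nonneg V_convergent])
  hence "0 \<le> N \<and> N ** (mat 1 - V) = mat 1 \<and> (mat 1 - V) ** N = mat 1"
    unfolding N_def by (intro someI) blast
  thus "0 \<le> N" "N ** (mat 1 - V) = mat 1" "(mat 1 - V) ** N = mat 1" by auto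
qed

section \<open>The rate matrix R\<close>

definition "R = U ** N"

lemma R_nonneg: "0 \<le> R" unfolding R_def by (intro mmul_nonneg U N_nonneg)

lemma N_D: "N ** D = G"
proof -
  have "D = (mat 1 - V) ** G"
    using G_eq by (simp add: V_def matrix_algebra algebra_simps)
  hence "N ** D = (N ** (mat 1 - V)) ** G" by (metis matrix_mul_assoc)
  thus ?thesis by (simp add: N_left)
qed

lemma R_D: "R ** D = U ** G"
  by (simp add: R_def matrix_mul_assoc[symmetric] N_D)

lemma R_eq: "R = U + R ** S + R ** R ** D"
proof -
  have "R ** R ** D = R ** (U ** G)" by (simp add: matrix_mul_assoc[symmetric] R_D)
  moreover have "R ** (mat 1 - V) = U" by (simp add: R_def matrix_mul_assoc[symmetric] N_left)
  ultimately show ?thesis by (simp add: V_def matrix_algebra algebra_simps)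
qed

lemma I_T_factor: "mat 1 - T = (mat 1 - R) ** (mat 1 - V)"
proof -
  have "R ** (mat 1 - V) = U" by (simp add: R_def matrix_mul_assoc[symmetric] N_left)
  thus ?thesis by (simp add: T_def mmul.diff_left)
qed

lemma I_R_inverse: "0 \<le> matrix_inv (mat 1 - R)"
  "matrix_inv (mat 1 - R) ** (mat 1 - R) = mat 1" "(mat 1 - R) ** matrix_inv (mat 1 - R) = mat 1"
proof -
  obtain M where M: "0 \<le> M" "M ** (mat 1 - T) = mat 1" "(mat 1 - T) ** M = mat 1"
    by (rule nonneg_inverse[OF T_nonneg T_convergent])
  \<comment> \<open>By \<open>I_T_factor\<close> the inverse of \<open>mat 1 - R\<close> must be
    \<open>(mat 1 - V) ** M\<close>; since \<open>mat 1 - V = mat 1 - T + U\<close>, this is the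
    visibly nonnegative \<open>B\<close>.\<close>
  define B where "B = mat 1 + U ** M"
  have "B = (mat 1 - V) ** M"
  proof -
    have "(mat 1 - V) ** M = (mat 1 - T) ** M + U ** M" by (simp add: T_def matrix_algebra)
    thus ?thesis by (simp add: B_def M)
  qed
  hence 1: "(mat 1 - R) ** B = mat 1" using M I_T_factor by (simp add: matrix_mul_assoc)
  hence 2: "B ** (mat 1 - R) = mat 1" using matrix_left_right_inverse by blast
  have "0 \<le> B" unfolding B_def by (intro add_nonneg_nonneg mmul_nonneg U M mat_1_nonneg)
  thus "0 \<le> matrix_inv (mat 1 - R)" "matrix_inv (mat 1 - R) ** (mat 1 - R) = mat 1"
     "(mat 1 - R) ** matrix_inv (mat 1 - R) = mat 1"
    using matrix_inv_eqI[OF 2 1] 1 2 by auto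
qed

text \<open>A solution \<open>Y \<le> R\<close> of the equation for \<open>R\<close> gives rise to a solution \<open>X \<le> G\<close> of the equation
  for \<open>G\<close>, so minimality of \<open>G\<close> forces \<open>Y = R\<close>.\<close>

lemma R_min_eq: "R_min U S D = R"
proof -
  let ?F = "\<lambda>X. U + X ** S + X ** X ** D"
  have nn: "0 \<le> ?F X" if "0 \<le> X" for X
    by (intro add_nonneg_nonneg mmul_nonneg D S U that)
  have mono: "?F X \<le> ?F Y" if "0 \<le> X" "X \<le> Y" for X Y
    by (intro add_mono mmul_mono_left mmul_mono_both order_refl S D that mmul_nonneg order_trans[OF that])
  define Y where "Y = (LEAST X. 0 \<le> X \<and> ?F X = X)"
  note L = least_fixed_point[of ?F R, folded Y_def]
  have RF: "?F R \<le> R" using R_eq by simp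
  have Y0: "0 \<le> Y" by (rule L(1); fact nn mono R_nonneg RF)
  have YF: "?F Y = Y" by (rule L(2); fact nn mono R_nonneg RF)
  have YR: "Y \<le> R" by (rule L(3); fact nn mono R_nonneg RF)
  \<comment> \<open>\<open>V\<close> with \<open>Y\<close> in the place of \<open>R\<close>, as
    \<open>R ** D = U ** G\<close>; dominated by \<open>V\<close>, it inherits the convergence
    property.\<close>
  define VY where "VY = S + Y ** D"
  have VY0: "0 \<le> VY" unfolding VY_def by (intro add_nonneg_nonneg mmul_nonneg S Y0 D)
  have VYV: "VY \<le> V" unfolding VY_def V_def R_D[symmetric] by (intro add_mono mmul_mono_left YR D order_refl)
  have conv: "u = 0" if "0 \<le> u" "u \<le> VY *v u" for u
    using that mvec_mono_left[OF VYV that(1)] by (intro V_convergent) (auto intro: order_trans)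
  obtain NY where NY: "0 \<le> NY" "NY ** (mat 1 - VY) = mat 1" "(mat 1 - VY) ** NY = mat 1"
    by (rule nonneg_inverse[OF VY0 conv])
  have "Y ** (mat 1 - VY) = U" using YF by (simp add: VY_def matrix_algebra algebra_simps)
  hence "Y ** ((mat 1 - VY) ** NY) = U ** NY" by (metis matrix_mul_assoc)
  hence YU: "Y = U ** NY" by (simp add: NY)
  define X where "X = NY ** D"
  have X0: "0 \<le> X" unfolding X_def by (intro mmul_nonneg NY D)
  have "(mat 1 - VY) ** X = D" by (simp add: X_def matrix_mul_assoc NY)
  moreover have YD: "Y ** D = U ** X" by (simp add: YU X_def matrix_mul_assoc)
  hence "Y ** (D ** X) = U ** (X ** X)" by (metis matrix_mul_assoc)
  ultimately have Xeq: "D + S ** X + U ** (X ** X) = X"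
    by (simp add: VY_def matrix_algebra algebra_simps)
  have "G \<le> X" by (rule G_least[OF X0 eq_refl[OF Xeq]])
  have "NY \<le> N"
  proof -
    \<comment> \<open>Resolvent identity; the right-hand side is nonnegative since
      \<open>VY \<le> V\<close>.\<close>
    have "N - NY = N ** (V - VY) ** NY"
    proof -
      have "N ** ((mat 1 - VY) - (mat 1 - V)) ** NY
          = N ** ((mat 1 - VY) ** NY) - (N ** (mat 1 - V)) ** NY"
        by (simp only: mmul.diff_left mmul.diff_right matrix_mul_assoc)
      thus ?thesis by (simp add: NY N_left)
    qed
    also have "0 \<le> \<dots>" using VYV by (intro mmul_nonneg N_nonneg NY) simp
    finally show ?thesis by simp
  qed
  hence "X \<le> G" unfolding X_def N_D[symmetric] by (intro mmul_mono_left D)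
  hence "X = G" using \<open>G \<le> X\<close> by (rule order_antisym)
  hence "VY = V" using YD by (simp add: VY_def V_def)
  hence "NY = N" by (metis NY(2) N_right matrix_mul_assoc matrix_mul_lid matrix_mul_rid)
  hence "Y = R" by (simp add: YU R_def)
  moreover have "R_min U S D = Y"
    unfolding R_min_def Y_def by (rule arg_cong[of _ _ Least]) (auto simp: fun_eq_iff)
  ultimately show ?thesis by simp
qed

end

section \<open>Perturbation of the matrix \<open>G\<close>\<close>

abbreviation has_slope :: "(real \<Rightarrow> 'a::real_normed_vector) \<Rightarrow> 'a \<Rightarrow> bool" (infix \<open>has'_slope\<close> 50) where
  "f has_slope f' \<equiv> ((\<lambda>z. (1 / (z - 1)) *\<^sub>R (f z - f 1)) \<longlongrightarrow> f') (at 1)"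

lemma has_slope_bound:
  assumes "f has_slope f'"
  obtains c where "0 < c" "\<forall>\<^sub>F z in at 1. norm (f z - f 1) \<le> c * \<bar>z - 1\<bar>"
proof -
  have "((\<lambda>z. norm ((1 / (z - 1)) *\<^sub>R (f z - f 1))) \<longlongrightarrow> norm f') (at 1)"
    by (intro tendsto_norm assms)
  hence "\<forall>\<^sub>F z in at 1. norm ((1 / (z - 1)) *\<^sub>R (f z - f 1)) < norm f' + 1"
    by (rule order_tendstoD) simp
  moreover have "\<forall>\<^sub>F z in at 1. z \<noteq> (1::real)" by (simp add: eventually_at_filter)
  ultimately have "\<forall>\<^sub>F z in at 1. norm (f z - f 1) \<le> (norm f' + 1) * \<bar>z - 1\<bar>"
  proof eventually_elim
    case (elim z)
    thus ?case unfolding norm_scaleR by (simp add: field_simps)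
  qed
  moreover have "0 < norm f' + 1" by (simp add: add_nonneg_pos)
  ultimately show ?thesis using that by blast
qed

lemma has_slope_tendsto:
  assumes "f has_slope f'"
  shows "(f \<longlongrightarrow> f 1) (at 1)"
proof -
  have "((\<lambda>z. (z - 1) *\<^sub>R ((1 / (z - 1)) *\<^sub>R (f z - f 1)) + f 1) \<longlongrightarrow> (1 - 1) *\<^sub>R f' + f 1) (at 1)"
    by (intro tendsto_intros assms)
  thus ?thesis
    by (simp add: Lim_transform_eventually eventually_at_filter)
qed

lemma mat_le_norm: "norm (A::real^'n^'n) \<le> r \<Longrightarrow> A \<le> r *\<^sub>R 1"
  using mat_norm_le[of A] by (auto simp: matrix_le_iff intro: order_trans)

lemma quadratic_norm_bound:
  obtains c where "0 \<le> c"
    "\<And>(A::real^'n^'n) (B::real^'n^'n) (C::real^'n^'n) (X::real^'n^'n). norm X \<le> b \<Longrightarrow>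
       norm (A + B ** X + C ** (X ** X)) \<le> c * (norm A + norm B + norm C)"
proof -
  obtain K where K: "0 < K" "\<And>(A::real^'n^'n) (B::real^'n^'n). norm (A ** B) \<le> norm A * norm B * K"
    using mmul.pos_bounded by blast
  define e where "e = \<bar>b\<bar> * K"
  have e0: "0 \<le> e" using K by (simp add: e_def)
  have mult: "norm (A ** X) \<le> norm A * e" if "norm X \<le> b" for A :: "real^'n^'n" and X :: "real^'n^'n"
  proof -
    have "norm (A ** X) \<le> norm A * (norm X * K)" using K(2)[of A X] by (simp add: mult_ac)
    also have "\<dots> \<le> norm A * e" unfolding e_def
      by (intro mult_left_mono mult_right_mono) (use K that in auto)
    finally show ?thesis .
  qed
  show ?thesis
  proof (rule that[of "1 + e + e * e"])
    show "0 \<le> 1 + e + e * e" using e0 by simp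
    fix A :: "real^'n^'n" and B :: "real^'n^'n" and C :: "real^'n^'n" and X :: "real^'n^'n"
    assume X: "norm X \<le> b"
    have "norm (C ** (X ** X)) \<le> norm (C ** X) * e" using mult[OF X, of "C ** X"] by (simp add: matrix_mul_assoc)
    also have "\<dots> \<le> norm C * e * e" by (intro mult_right_mono mult X e0)
    finally have 1: "norm (C ** (X ** X)) \<le> norm C * e * e" .
    have "norm (A + B ** X + C ** (X ** X)) \<le> norm A + norm (B ** X) + norm (C ** (X ** X))"
      by (intro order_trans[OF norm_triangle_ineq] add_mono order_refl)
    also have "\<dots> \<le> norm A + norm B * e + norm C * e * e" by (intro add_mono 1 mult X order_refl)
    also have "\<dots> \<le> (1 + e + e * e) * (norm A + norm B + norm C)"
      using e0 by (simp add: algebra_simps)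
    finally show "norm (A + B ** X + C ** (X ** X)) \<le> (1 + e + e * e) * (norm A + norm B + norm C)" .
  qed
qed

section \<open>Linearization of the equation for G\<close>

context downward_qbd
begin

text \<open>Derivative of \<open>X - (D + S ** X + U ** (X ** X))\<close> at \<open>G\<close> in the
  direction \<open>X\<close>; the term \<open>U ** (G ** X)\<close> is absorbed in
  \<open>V ** X\<close>.\<close>

definition "L X = X - V ** X - U ** (X ** G)"

lemma linear_L: "linear L"
  by (rule linearI) (simp_all add: L_def matrix_algebra algebra_simps)

text \<open>The matrix \<open>Y\<close> of negative parts of \<open>X\<close> satisfies
  \<open>Y \<le> V ** Y + U ** (Y ** G)\<close>. Taking row sums removes the stochastic right factor
  \<open>G\<close> and leaves \<open>Y *v 1 \<le> T *v (Y *v 1)\<close>.\<close>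

lemma L_nonneg_imp:
  assumes "0 \<le> L X"
  shows "0 \<le> X"
proof -
  define Y where "Y = (\<chi> i j. max (- X$i$j) 0)"
  have Y: "0 \<le> Y" "- X \<le> Y" by (auto simp: Y_def matrix_le_iff)
  have "V ** (- X) + U ** (- X ** G) \<le> V ** Y + U ** (Y ** G)"
    by (intro add_mono mmul_mono mmul_mono_left V_nonneg U G_nonneg Y)
  hence "- X \<le> V ** Y + U ** (Y ** G)"
    using assms by (simp add: L_def matrix_algebra matrix_le_iff) (smt (verit))
  moreover have "0 \<le> V ** Y + U ** (Y ** G)"
    by (intro add_nonneg_nonneg mmul_nonneg V_nonneg U Y G_nonneg)
  ultimately have "Y \<le> V ** Y + U ** (Y ** G)"
    by (simp add: Y_def matrix_le_iff)
  hence "Y *v 1 \<le> (V ** Y + U ** (Y ** G)) *v 1" by (rule mvec_mono_left) (simp add: vec_le_iff)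
  also have "\<dots> = T *v (Y *v 1)" by (simp add: T_def matrix_algebra G_stochastic)
  finally have "Y *v 1 = 0" by (intro T_convergent mvec_nonneg Y) (simp add: vec_le_iff)
  hence "(\<Sum>j\<in>UNIV. Y$i$j) = 0" for i by (simp add: vec_eq_iff matrix_vector_mult_def)
  hence "Y$i$j = 0" for i j
    using Y(1) by (subst (asm) sum_nonneg_eq_0_iff) (auto simp: matrix_le_iff)
  thus ?thesis using Y(2) by (simp add: matrix_le_iff)
qed

lemma L_left_inverse:
  obtains g :: "real^'n^'n \<Rightarrow> real^'n^'n" where "linear g" "\<And>X. g (L X) = X" "\<And>X. L (g X) = X"
proof -
  have "X = 0" if "L X = 0" for X
    using L_nonneg_imp[of X] L_nonneg_imp[of "- X"] that linear_neg[OF linear_L, of X]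
    by (simp add: matrix_le_iff vec_eq_iff order_antisym)
  hence "inj L" using linear_injective_0[OF linear_L] by blast
  from linear_injective_isomorphism[OF linear_L this] show ?thesis using that by blast
qed

text \<open>With \<open>E\<close> such that \<open>L E\<close> is the matrix of ones, \<open>G + \<epsilon> E\<close> is a supersolution of the perturbed
  equation and \<open>H + \<epsilon> E\<close>, where \<open>H\<close> is its minimal solution, one of the unperturbed equation, if
  \<open>\<epsilon>\<close> is a suitable multiple of the size \<open>p\<close> of the perturbation.\<close>

lemma G_min_Lipschitz:
  obtains c \<delta> where "0 \<le> c" "0 < \<delta>"
    "\<And>D2 S2 U2 :: real^'n^'n. 0 \<le> D2 \<Longrightarrow> 0 \<le> S2 \<Longrightarrow> 0 \<le> U2 \<Longrightarrow>
       norm (D2 - D) + norm (S2 - S) + norm (U2 - U) \<le> \<delta> \<Longrightarrow>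
       0 \<le> G_min U2 S2 D2 \<and>
       D2 + S2 ** G_min U2 S2 D2 + U2 ** (G_min U2 S2 D2 ** G_min U2 S2 D2) = G_min U2 S2 D2 \<and>
       norm (G_min U2 S2 D2 - G) \<le> c * (norm (D2 - D) + norm (S2 - S) + norm (U2 - U))"
proof -
  obtain g :: "real^'n^'n \<Rightarrow> real^'n^'n" where g: "L (g 1) = 1" using L_left_inverse by blast
  define E where "E = g 1"
  have LE: "L E = 1" by (simp add: E_def g)
  have E0: "0 \<le> E" by (rule L_nonneg_imp) (simp add: LE matrix_le_iff)
  have LE': "S ** E + U ** (G ** E) + U ** (E ** G) = E - 1"
    using LE by (simp add: L_def V_def matrix_algebra algebra_simps)
  define Q where "Q = norm (U ** (E ** E))"
  have Q: "0 \<le> Q" "U ** (E ** E) \<le> Q *\<^sub>R 1" by (auto simp: Q_def intro: mat_norm_le)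
  obtain c where c: "0 \<le> c" "\<And>(A::real^'n^'n) (B::real^'n^'n) (C::real^'n^'n) (X::real^'n^'n). norm X \<le> norm (G + E) \<Longrightarrow>
       norm (A + B ** X + C ** (X ** X)) \<le> c * (norm A + norm B + norm C)"
    by (rule quadratic_norm_bound[of "norm (G + E)"]) blast
  \<comment> \<open>Chosen so that \<open>\<epsilon> * (1 + 6 * Q) \<le> 1\<close> below: \<epsilon>
    \<le> 1 keeps G + \<epsilon> E below \<open>G + E\<close>, for which \<open>c\<close> was
    obtained, and 6 \<epsilon> Q \<le> 1 keeps the quadratic terms small.\<close>
  define \<delta> where "\<delta> = 1 / (2 * (c + 1) * (1 + 6 * Q))"
  have \<delta>: "0 < \<delta>" using c Q by (simp add: \<delta>_def add_nonneg_pos add_pos_nonneg)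
  have main: "0 \<le> H \<and> D2 + S2 ** H + U2 ** (H ** H) = H \<and> norm (H - G) \<le> (2 * c * norm E) * p"
    if nn: "0 \<le> D2" "0 \<le> S2" "0 \<le> U2" and p: "p = norm (D2 - D) + norm (S2 - S) + norm (U2 - U)" "p \<le> \<delta>"
      and H: "H = G_min U2 S2 D2" for D2 S2 U2 H :: "real^'n^'n" and p
  proof -
    \<comment> \<open>The shift by \<epsilon> E gains \<epsilon> = 2 c p in every entry. One half
      pays for the perturbed blocks, the other for quadratic terms of at most 3 \<epsilon>^2 Q: one
      from expanding the square and, in the comparison for \<open>G\<close>, two more from replacing
      \<open>H\<close> by its upper bound.\<close>
    define \<epsilon> where "\<epsilon> = 2 * c * p"
    have p0: "0 \<le> p" using p by simp
    have \<epsilon>0: "0 \<le> \<epsilon>" using c p0 by (simp add: \<epsilon>_def)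
    have "\<epsilon> * (1 + 6 * Q) \<le> 1"
    proof -
      have "\<epsilon> * (1 + 6 * Q) \<le> (2 * (c + 1) * \<delta>) * (1 + 6 * Q)"
        unfolding \<epsilon>_def using c Q p p0 by (intro mult_mono mult_right_mono) auto
      also have "\<dots> = 1" using c Q by (simp add: \<delta>_def)
      finally show ?thesis .
    qed
    hence \<epsilon>1: "\<epsilon> + 6 * (\<epsilon> * Q) \<le> 1" by (simp add: algebra_simps)
    have \<epsilon>Q0: "0 \<le> \<epsilon> * Q" using \<epsilon>0 Q by simp
    have "\<epsilon> * (6 * (\<epsilon> * Q)) \<le> \<epsilon> * 1" by (intro mult_left_mono \<epsilon>0) (use \<epsilon>1 \<epsilon>0 in simp)
    hence \<epsilon>2: "3 * (\<epsilon> * \<epsilon> * Q) \<le> c * p" by (simp add: \<epsilon>_def mult_ac)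
    have UEE: "(\<epsilon> * \<epsilon>) *\<^sub>R (U ** (E ** E)) \<le> (\<epsilon> * \<epsilon> * Q) *\<^sub>R 1"
      using scaleR_left_mono[OF Q(2), of "\<epsilon> * \<epsilon>"] \<epsilon>0 by simp
    have GE: "G + \<epsilon> *\<^sub>R E \<le> G + E"
      using scaleR_right_mono[of \<epsilon> 1 E] \<epsilon>1 \<epsilon>Q0 E0 by (intro add_left_mono) simp
    have small: "norm X \<le> norm (G + E)" if "0 \<le> X" "X \<le> G + \<epsilon> *\<^sub>R E" for X
      by (rule mat_norm_mono[OF that(1) order_trans[OF that(2) GE]])
    have diff: "(D2 - D) + (S2 - S) ** X + (U2 - U) ** (X ** X) \<le> (c * p) *\<^sub>R 1"
       "(D - D2) + (S - S2) ** X + (U - U2) ** (X ** X) \<le> (c * p) *\<^sub>R 1"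
      if "0 \<le> X" "X \<le> G + \<epsilon> *\<^sub>R E" for X
    proof -
      have "norm ((D2 - D) + (S2 - S) ** X + (U2 - U) ** (X ** X)) \<le> c * p"
        using c(2)[OF small[OF that], of "D2 - D" "S2 - S" "U2 - U"] by (simp add: p)
      thus "(D2 - D) + (S2 - S) ** X + (U2 - U) ** (X ** X) \<le> (c * p) *\<^sub>R 1" by (rule mat_le_norm)
      have "norm ((D - D2) + (S - S2) ** X + (U - U2) ** (X ** X)) \<le> c * p"
        using c(2)[OF small[OF that], of "D - D2" "S - S2" "U - U2"] by (simp add: p norm_minus_commute)
      thus "(D - D2) + (S - S2) ** X + (U - U2) ** (X ** X) \<le> (c * p) *\<^sub>R 1" by (rule mat_le_norm)
    qed
    let ?F = "\<lambda>X. D2 + S2 ** X + U2 ** (X ** X)"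
    have nnF: "0 \<le> ?F X" if "0 \<le> X" for X
      by (intro add_nonneg_nonneg mmul_nonneg nn that)
    have monoF: "?F X \<le> ?F Y" if "0 \<le> X" "X \<le> Y" for X Y
      by (intro add_mono mmul_mono order_refl nn that mmul_mono_both)
    define X where "X = G + \<epsilon> *\<^sub>R E"
    have X0: "0 \<le> X" unfolding X_def by (intro add_nonneg_nonneg G_nonneg scaleR_nonneg_nonneg \<epsilon>0 E0)
    have "?F X = (D + S ** X + U ** (X ** X)) + ((D2 - D) + (S2 - S) ** X + (U2 - U) ** (X ** X))"
      by (simp add: mmul.diff_left algebra_simps)
    also have "\<dots> \<le> (D + S ** X + U ** (X ** X)) + (c * p) *\<^sub>R 1"
      using diff(1)[OF X0] by (intro add_left_mono) (simp add: X_def)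
    also have "D + S ** X + U ** (X ** X) = (D + S ** G + U ** (G ** G))
        + \<epsilon> *\<^sub>R (S ** E + U ** (G ** E) + U ** (E ** G)) + (\<epsilon> * \<epsilon>) *\<^sub>R (U ** (E ** E))"
      by (simp add: X_def matrix_algebra algebra_simps)
    also have "\<dots> = X - \<epsilon> *\<^sub>R 1 + (\<epsilon> * \<epsilon>) *\<^sub>R (U ** (E ** E))"
      unfolding LE' G_eq by (simp add: X_def algebra_simps)
    finally have "?F X \<le> X + (c * p - \<epsilon>) *\<^sub>R 1 + (\<epsilon> * \<epsilon>) *\<^sub>R (U ** (E ** E))"
      by (simp add: algebra_simps)
    also have "\<dots> \<le> X + (c * p - \<epsilon>) *\<^sub>R 1 + (\<epsilon> * \<epsilon> * Q) *\<^sub>R 1"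
      by (intro add_left_mono UEE)
    also have "\<dots> \<le> X"
      using \<epsilon>2 \<epsilon>0 Q(1) by (simp add: matrix_le_iff \<epsilon>_def)
    finally have FX: "?F X \<le> X" .
    have Hdef: "H = (LEAST X. 0 \<le> X \<and> ?F X = X)"
      by (simp add: H G_min_def matrix_mul_assoc)
    note lfp = least_fixed_point[of ?F X, folded Hdef]
    have H0: "0 \<le> H" by (rule lfp(1); fact nnF monoF X0 FX)
    have FH: "?F H = H" by (rule lfp(2); fact nnF monoF X0 FX)
    have HX: "H \<le> X" by (rule lfp(3); fact nnF monoF X0 FX)
    have "G \<le> H + \<epsilon> *\<^sub>R E"
    proof (rule G_least)
      show "0 \<le> H + \<epsilon> *\<^sub>R E" by (intro add_nonneg_nonneg H0 scaleR_nonneg_nonneg \<epsilon>0 E0)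
      have "D + S ** H + U ** (H ** H) = ?F H + ((D - D2) + (S - S2) ** H + (U - U2) ** (H ** H))"
        by (simp add: mmul.diff_left algebra_simps)
      also have "\<dots> \<le> H + (c * p) *\<^sub>R 1"
        unfolding FH using diff(2)[OF H0] HX by (intro add_left_mono) (simp add: X_def)
      finally have 1: "D + S ** H + U ** (H ** H) \<le> H + (c * p) *\<^sub>R 1" .
      have "S ** E + U ** (H ** E) + U ** (E ** H) \<le> S ** E + U ** (X ** E) + U ** (E ** X)"
        by (intro add_mono order_refl mmul_mono mmul_mono_left U E0 HX)
      also have "\<dots> = (S ** E + U ** (G ** E) + U ** (E ** G)) + (2 * \<epsilon>) *\<^sub>R (U ** (E ** E))"
        unfolding mult_2 scaleR_add_left by (simp add: X_def matrix_algebra)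
      finally have "\<epsilon> *\<^sub>R (S ** E + U ** (H ** E) + U ** (E ** H)) \<le>
          \<epsilon> *\<^sub>R (E - 1 + (2 * \<epsilon>) *\<^sub>R (U ** (E ** E)))"
        unfolding LE' by (rule scaleR_left_mono[OF _ \<epsilon>0])
      hence 2: "\<epsilon> *\<^sub>R (S ** E + U ** (H ** E) + U ** (E ** H)) \<le>
          \<epsilon> *\<^sub>R E - \<epsilon> *\<^sub>R 1 + 2 *\<^sub>R ((\<epsilon> * \<epsilon>) *\<^sub>R (U ** (E ** E)))"
        by (simp add: algebra_simps)
      have "D + S ** (H + \<epsilon> *\<^sub>R E) + U ** ((H + \<epsilon> *\<^sub>R E) ** (H + \<epsilon> *\<^sub>R E))
         = (D + S ** H + U ** (H ** H)) + \<epsilon> *\<^sub>R (S ** E + U ** (H ** E) + U ** (E ** H))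
           + (\<epsilon> * \<epsilon>) *\<^sub>R (U ** (E ** E))"
        by (simp add: matrix_algebra algebra_simps)
      also have "\<dots> \<le> (H + (c * p) *\<^sub>R 1) + (\<epsilon> *\<^sub>R E - \<epsilon> *\<^sub>R 1 + 2 *\<^sub>R ((\<epsilon> * \<epsilon> * Q) *\<^sub>R 1)) + (\<epsilon> * \<epsilon> * Q) *\<^sub>R 1"
        by (intro add_mono 1 UEE order_trans[OF 2] scaleR_left_mono order_refl) simp
      also have "\<dots> \<le> H + \<epsilon> *\<^sub>R E"
        using \<epsilon>2 by (simp add: matrix_le_iff \<epsilon>_def mult_ac)
      finally show "D + S ** (H + \<epsilon> *\<^sub>R E) + U ** ((H + \<epsilon> *\<^sub>R E) ** (H + \<epsilon> *\<^sub>R E)) \<le> H + \<epsilon> *\<^sub>R E" .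
    qed
    hence "- (\<epsilon> *\<^sub>R E) \<le> H - G" by (simp add: algebra_simps)
    moreover have "H - G \<le> \<epsilon> *\<^sub>R E" using HX by (simp add: X_def algebra_simps)
    ultimately have "norm (H - G) \<le> norm (\<epsilon> *\<^sub>R E)" by (rule mat_norm_bound)
    also have "\<dots> = (2 * c * norm E) * p" using \<epsilon>0 by (simp add: \<epsilon>_def mult_ac)
    finally show ?thesis using H0 FH by simp
  qed
  have "0 \<le> 2 * c * norm E" using c by simp
  from this \<delta> main[OF _ _ _ refl _ refl] show ?thesis by (rule that)
qed

text \<open>The Lipschitz bound keeps the difference quotients \<open>q\<close> bounded, so in
  \<open>L (q z) = rhs z\<close> the quadratic remainder tends to 0 and the right-hand side
  converges. The inverse of \<open>L\<close> transfers the limit to \<open>q\<close>.\<close>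

lemma G_min_has_slope:
  fixes Dz Sz Uz :: "real \<Rightarrow> real^'n^'n"
  assumes at_1: "Dz 1 = D" "Sz 1 = S" "Uz 1 = U"
    and slope: "Dz has_slope D'" "Sz has_slope S'" "Uz has_slope U'"
    and nn: "\<forall>\<^sub>F z in at 1. 0 \<le> Dz z \<and> 0 \<le> Sz z \<and> 0 \<le> Uz z"
  defines "Gz \<equiv> \<lambda>z. G_min (Uz z) (Sz z) (Dz z)"
  obtains G' where "Gz has_slope G'" "L G' = D' + S' ** G + U' ** (G ** G)"
    "\<forall>\<^sub>F z in at 1. 0 \<le> Gz z"
proof -
  have G1: "Gz 1 = G" by (simp add: Gz_def at_1 G_def)
  obtain c \<delta> where c: "0 \<le> c" "0 < \<delta>"
    "\<And>D2 S2 U2 :: real^'n^'n. 0 \<le> D2 \<Longrightarrow> 0 \<le> S2 \<Longrightarrow> 0 \<le> U2 \<Longrightarrow>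
       norm (D2 - D) + norm (S2 - S) + norm (U2 - U) \<le> \<delta> \<Longrightarrow>
       0 \<le> G_min U2 S2 D2 \<and>
       D2 + S2 ** G_min U2 S2 D2 + U2 ** (G_min U2 S2 D2 ** G_min U2 S2 D2) = G_min U2 S2 D2 \<and>
       norm (G_min U2 S2 D2 - G) \<le> c * (norm (D2 - D) + norm (S2 - S) + norm (U2 - U))"
    by (rule G_min_Lipschitz) blast
  define p where "p z = norm (Dz z - D) + norm (Sz z - S) + norm (Uz z - U)" for z
  have "(p \<longlongrightarrow> norm (Dz 1 - D) + norm (Sz 1 - S) + norm (Uz 1 - U)) (at 1)"
    unfolding p_def by (intro tendsto_intros has_slope_tendsto[OF slope(1)] has_slope_tendsto[OF slope(2)]
      has_slope_tendsto[OF slope(3)])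
  hence p0: "(p \<longlongrightarrow> 0) (at 1)" by (simp add: at_1)
  hence "\<forall>\<^sub>F z in at 1. p z < \<delta>" using c(2) by (rule order_tendstoD)
  hence ev: "\<forall>\<^sub>F z in at 1. 0 \<le> Gz z \<and> Dz z + Sz z ** Gz z + Uz z ** (Gz z ** Gz z) = Gz z \<and> norm (Gz z - G) \<le> c * p z"
    using nn by eventually_elim (use c(3) in \<open>auto simp: Gz_def p_def\<close>)
  have "((\<lambda>z. c * p z) \<longlongrightarrow> 0) (at 1)" using tendsto_mult_right_zero[OF p0] .
  moreover have "\<forall>\<^sub>F z in at 1. norm (Gz z - G) \<le> c * p z" using ev by (rule eventually_mono) blast
  ultimately have H0: "((\<lambda>z. Gz z - G) \<longlongrightarrow> 0) (at 1)"
    by (rule Lim_null_comparison[rotated])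
  hence Glim: "(Gz \<longlongrightarrow> G) (at 1)" by (simp add: LIM_zero_iff)
  obtain d1 where d1: "0 < d1" "\<forall>\<^sub>F z in at 1. norm (Dz z - Dz 1) \<le> d1 * \<bar>z - 1\<bar>"
    using has_slope_bound[OF slope(1)] by blast
  obtain d2 where d2: "0 < d2" "\<forall>\<^sub>F z in at 1. norm (Sz z - Sz 1) \<le> d2 * \<bar>z - 1\<bar>"
    using has_slope_bound[OF slope(2)] by blast
  obtain d3 where d3: "0 < d3" "\<forall>\<^sub>F z in at 1. norm (Uz z - Uz 1) \<le> d3 * \<bar>z - 1\<bar>"
    using has_slope_bound[OF slope(3)] by blast
  define q where "q z = (1 / (z - 1)) *\<^sub>R (Gz z - G)" for z
  define d where "d = c * (d1 + d2 + d3)"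
  have ne: "\<forall>\<^sub>F z in at 1. z \<noteq> (1::real)" by (simp add: eventually_at_filter)
  have qb: "\<forall>\<^sub>F z in at 1. norm (q z) \<le> d"
    using ev d1(2) d2(2) d3(2) ne
  proof eventually_elim
    case (elim z)
    have "p z \<le> (d1 + d2 + d3) * \<bar>z - 1\<bar>" using elim at_1 by (simp add: p_def algebra_simps)
    hence "c * p z \<le> c * ((d1 + d2 + d3) * \<bar>z - 1\<bar>)" by (rule mult_left_mono[OF _ c(1)])
    hence "norm (Gz z - G) \<le> d * \<bar>z - 1\<bar>" using elim by (simp add: d_def mult_ac)
    thus ?case using elim by (simp add: q_def divide_le_eq)
  qed
  have qH: "((\<lambda>z. q z ** (Gz z - G)) \<longlongrightarrow> 0) (at 1)"
  proof -
    obtain K where K: "0 < K" "\<And>(A::real^'n^'n) (B::real^'n^'n). norm (A ** B) \<le> norm A * norm B * K"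
      using mmul.pos_bounded by blast
    have "((\<lambda>z. d * norm (Gz z - G) * K) \<longlongrightarrow> 0) (at 1)"
      by (intro tendsto_mult_left_zero tendsto_mult_right_zero tendsto_norm_zero H0)
    moreover have "\<forall>\<^sub>F z in at 1. norm (q z ** (Gz z - G)) \<le> d * norm (Gz z - G) * K"
      using qb
    proof eventually_elim
      case (elim z)
      have "norm (q z ** (Gz z - G)) \<le> norm (q z) * norm (Gz z - G) * K" by (rule K)
      also have "\<dots> \<le> d * norm (Gz z - G) * K"
        using elim K by (intro mult_right_mono) auto
      finally show ?case .
    qed
    ultimately show ?thesis by (rule Lim_null_comparison[rotated])
  qed
  define rhs where "rhs z = U ** (q z ** (Gz z - G)) + (1 / (z - 1)) *\<^sub>R (Dz z - Dz 1)
     + (1 / (z - 1)) *\<^sub>R (Sz z - Sz 1) ** Gz z + (1 / (z - 1)) *\<^sub>R (Uz z - Uz 1) ** (Gz z ** Gz z)" for z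
  have "(rhs \<longlongrightarrow> U ** 0 + D' + S' ** G + U' ** (G ** G)) (at 1)"
    unfolding rhs_def by (intro tendsto_add mmul.tendsto tendsto_const qH slope Glim)
  hence rhs: "(rhs \<longlongrightarrow> D' + S' ** G + U' ** (G ** G)) (at 1)" by simp
  have Lq: "\<forall>\<^sub>F z in at 1. L (q z) = rhs z"
    using ev
  proof eventually_elim
    case (elim z)
    define H where "H = Gz z - G"
    have GH: "Gz z = G + H" by (simp add: H_def)
    have 1: "Dz z + Sz z ** Gz z + Uz z ** (Gz z ** Gz z) = G + H" using elim GH by simp
    have "U ** (H ** H) + (Dz z - D) + (Sz z - S) ** Gz z + (Uz z - U) ** (Gz z ** Gz z)
        = (Dz z + Sz z ** Gz z + Uz z ** (Gz z ** Gz z)) - (D + S ** G + U ** (G ** G)) - (V ** H + U ** (H ** G))"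
      by (simp add: GH V_def matrix_algebra algebra_simps)
    also have "\<dots> = L H" by (simp only: 1 G_eq) (simp add: L_def)
    finally have LH: "L H = U ** (H ** H) + (Dz z - D) + (Sz z - S) ** Gz z + (Uz z - U) ** (Gz z ** Gz z)"
      by simp
    have "L (q z) = (1 / (z - 1)) *\<^sub>R L H"
      by (simp add: q_def H_def linear_scale[OF linear_L])
    thus ?case
      unfolding LH rhs_def at_1 q_def H_def[symmetric]
      by (simp only: scaleR_add_right mmul.scaleR_left mmul.scaleR_right)
  qed
  obtain g :: "real^'n^'n \<Rightarrow> real^'n^'n" where g: "linear g" "\<And>X. g (L X) = X" "\<And>X. L (g X) = X"
    using L_left_inverse by blast
  have "((\<lambda>z. g (rhs z)) \<longlongrightarrow> g (D' + S' ** G + U' ** (G ** G))) (at 1)"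
    by (rule bounded_linear.tendsto[OF linear_conv_bounded_linear[THEN iffD1, OF g(1)] rhs])
  hence "(q \<longlongrightarrow> g (D' + S' ** G + U' ** (G ** G))) (at 1)"
    by (rule Lim_transform_eventually) (rule eventually_mono[OF Lq], drule arg_cong[of _ _ g], simp only: g(2))
  hence "Gz has_slope g (D' + S' ** G + U' ** (G ** G))" by (simp add: q_def[abs_def] G1)
  moreover have "\<forall>\<^sub>F z in at 1. 0 \<le> Gz z" using ev by (rule eventually_mono) simp
  ultimately show ?thesis using that g(3) by blast
qed

end

section \<open>Irreducible chains\<close>

text \<open>Irreducibility enters only through the absence of proper closed sets.\<close>

definition no_proper_closed_set :: "('s \<Rightarrow> 's \<Rightarrow> real) \<Rightarrow> bool" where
  "no_proper_closed_set P \<longleftrightarrow>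
     (\<forall>C. C \<noteq> {} \<and> (\<forall>x\<in>C. \<forall>y. 0 < P x y \<longrightarrow> y \<in> C) \<longrightarrow> C = UNIV)"

lemma no_proper_closed_setD:
  assumes "no_proper_closed_set P" "x \<in> C" "\<And>x y. x \<in> C \<Longrightarrow> 0 < P x y \<Longrightarrow> y \<in> C"
  shows "y \<in> C"
  using assms unfolding no_proper_closed_set_def by blast

lemma irreducible_chain_imp_no_proper_closed_set:
  assumes "irreducible_chain P"
  shows "no_proper_closed_set P"
proof -
  have reach: "y \<in> C" if C: "\<And>x y. x \<in> C \<Longrightarrow> 0 < P x y \<Longrightarrow> y \<in> C"
    and "x \<in> C" "0 < mpow (\<lambda>x y. ennreal (P x y)) n x y" for C x y n
    using that(3)
  proof (induction n arbitrary: y)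
    case 0
    thus ?case using \<open>x \<in> C\<close> by (simp split: if_splits)
  next
    case (Suc n)
    show ?case
    proof (rule ccontr)
      assume y: "y \<notin> C"
      have "mpow (\<lambda>x y. ennreal (P x y)) n x z * ennreal (P z y) = 0" for z
      proof (cases "z \<in> C")
        case True
        hence "P z y \<le> 0" using C y by force
        thus ?thesis by (simp add: ennreal_neg)
      next
        case False
        hence "\<not> 0 < mpow (\<lambda>x y. ennreal (P x y)) n x z" using Suc.IH by blast
        thus ?thesis by simp
      qed
      hence "mpow (\<lambda>x y. ennreal (P x y)) (Suc n) x y = 0"
        unfolding mpow.simps mmult_def by (intro infsum_0) blast
      thus False using Suc.prems by simp
    qed
  qed
  show ?thesis
    unfolding no_proper_closed_set_def
  proof (intro allI impI, elim conjE)
    fix C assume C: "C \<noteq> {}" "\<forall>x\<in>C. \<forall>y. 0 < P x y \<longrightarrow> y \<in> C"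
    then obtain x where "x \<in> C" by blast
    have "y \<in> C" for y
    proof -
      obtain n where "0 < mpow (\<lambda>x y. ennreal (P x y)) n x y"
        using assms unfolding irreducible_chain_def irreducible_matrix_def by blast
      from reach[OF _ \<open>x \<in> C\<close> this] show ?thesis using C(2) by blast
    qed
    thus "C = UNIV" by blast
  qed
qed

text \<open>Preimages of closed sets are closed. In this way irreducibility passes from the
  two-dimensional chains to the phase chain and the level process, and to chains with the
  coordinates exchanged.\<close>

lemma no_proper_closed_set_image:
  assumes P: "no_proper_closed_set P"
    and step: "\<And>x y. 0 < P x y \<Longrightarrow> 0 < Q (f x) (f y)" and f: "surj f"
  shows "no_proper_closed_set Q"
  unfolding no_proper_closed_set_def
proof (intro allI impI, elim conjE)
  fix C assume C: "C \<noteq> {}" "\<forall>x\<in>C. \<forall>y. 0 < Q x y \<longrightarrow> y \<in> C"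
  obtain x where x: "f x \<in> C" using C(1) f by (metis ex_in_conv surjD)
  have "y \<in> f -` C" for y
    by (rule no_proper_closed_setD[OF P, of x]) (use x C(2) step in auto)
  thus "C = UNIV" using f by (metis UNIV_eq_I surjD vimageD)
qed

text \<open>The support of \<open>p\<close> is nonempty and closed under transitions.\<close>

lemma stationary_distribution_pos:
  assumes P: "no_proper_closed_set P" "\<And>x y. 0 \<le> P x y"
    and p: "is_stationary_distribution P p"
  shows "0 < p x"
proof -
  have p0: "0 \<le> p x" and p1: "(p has_sum 1) UNIV" and pP: "((\<lambda>x. p x * P x y) has_sum p y) UNIV" for x y
    using p by (auto simp: is_stationary_distribution_def)
  have "\<exists>x. p x \<noteq> 0"
  proof (rule ccontr)
    assume "\<not> (\<exists>x. p x \<noteq> 0)"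
    hence "p = (\<lambda>_. 0)" by auto
    hence "(1::real) = 0" using p1 has_sum_unique[OF p1, of 0] by simp
    thus False by simp
  qed
  then obtain x0 where "0 < p x0" using p0 by (metis less_le)
  hence "x0 \<in> {x. 0 < p x}" by simp
  from P(1) this have "x \<in> {x. 0 < p x}"
  proof (rule no_proper_closed_setD)
    fix x y assume xy: "x \<in> {x. 0 < p x}" "0 < P x y"
    have "((\<lambda>x. p x * P x y) has_sum p x * P x y) {x}" by (intro has_sum_finiteI) auto
    hence "p x * P x y \<le> p y"
      by (rule has_sum_mono_neutral[OF _ pP]) (use p0 P(2) in auto)
    moreover have "0 < p x * P x y" using xy by simp
    ultimately have "0 < p y" by linarith
    thus "y \<in> {x. 0 < p x}" by simp
  qed
  thus ?thesis by simp
qed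

text \<open>The positive part \<open>d\<close> of the difference of two stationary distributions is subinvariant, hence
  invariant since both sides have the same total mass, so it is positive everywhere or zero.\<close>

lemma stationary_distribution_unique:
  assumes P: "no_proper_closed_set P" "\<And>x y. 0 \<le> P x y" "\<And>x. ((\<lambda>y. P x y) has_sum 1) UNIV"
    and p: "is_stationary_distribution P p" and q: "is_stationary_distribution P q"
  shows "p = q"
proof -
  have p0: "0 \<le> p x" and p1: "(p has_sum 1) UNIV" and pP: "((\<lambda>x. p x * P x y) has_sum p y) UNIV" for x y
    using p by (auto simp: is_stationary_distribution_def)
  have q0: "0 \<le> q x" and q1: "(q has_sum 1) UNIV" and qP: "((\<lambda>x. q x * P x y) has_sum q y) UNIV" for x y
    using q by (auto simp: is_stationary_distribution_def)
  have sub: "((\<lambda>x. f x - g x) has_sum a - b) UNIV" if "(f has_sum a) UNIV" "(g has_sum b) UNIV"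
    for f g :: "_ \<Rightarrow> real" and a b
    using has_sum_add[OF that(1) has_sum_uminusI[OF that(2)]] by simp
  define d where "d x = max (p x - q x) 0" for x
  have d0: "0 \<le> d x" for x by (simp add: d_def)
  have dp: "d x \<le> p x" for x using p0 q0 by (simp add: d_def)
  define h where "h y = (\<Sum>\<^sub>\<infinity>x. d x * P x y)" for y
  have h: "((\<lambda>x. d x * P x y) has_sum h y) UNIV" for y
  proof -
    have "(\<lambda>x. d x * P x y) summable_on UNIV"
      by (rule summable_on_comparison_test[of "\<lambda>x. p x * P x y"])
         (use pP d0 dp P(2) in \<open>auto simp: summable_on_def intro!: mult_right_mono\<close>)
    thus ?thesis by (simp add: h_def)
  qed
  have dh: "d y \<le> h y" for y
  proof -
    have "p y - q y \<le> h y"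
    proof (rule has_sum_mono[OF sub[OF pP qP] h])
      show "p x * P x y - q x * P x y \<le> d x * P x y" for x
        using mult_right_mono[of "p x - q x" "d x" "P x y"] P(2) by (simp add: d_def algebra_simps)
    qed
    moreover have "0 \<le> h y" by (rule has_sum_nonneg[OF h]) (simp add: d0 P)
    ultimately show ?thesis by (simp add: d_def)
  qed
  obtain s where ds: "(d has_sum s) UNIV"
    using summable_on_comparison_test[of p UNIV d] p1 d0 dp by (auto simp: summable_on_def)
  have row: "((\<lambda>y. (\<lambda>(x, y). d x * P x y) (x, y)) has_sum d x) UNIV" for x
    using has_sum_cmult_right[OF P(3), of "d x" x] by simp
  \<comment> \<open>Tonelli: summing \<open>d x * P x y\<close> by rows gives \<open>s\<close>, by
    columns the total mass of \<open>h\<close>.\<close>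
  have "(\<lambda>(x, y). d x * P x y) summable_on (UNIV \<times> UNIV)"
    by (rule summable_on_SigmaI[OF row]) (use ds d0 P(2) in \<open>auto simp: summable_on_def\<close>)
  from has_sum_SigmaI[OF row ds this]
  have "((\<lambda>(y, x). d x * P x y) has_sum s) (UNIV \<times> UNIV)"
    by (subst has_sum_swap) simp
  hence "(h has_sum s) UNIV"
    by (rule has_sum_SigmaD) (use h in simp)
  from sub[OF this ds] have "((\<lambda>x. h x - d x) has_sum 0) UNIV" by simp
  hence "h x - d x = 0" for x
    by (rule nonneg_has_sum_le_0D) (use dh in auto)
  hence hd: "h x = d x" for x by (simp add: algebra_simps)
  have eq: "p = q" if "\<And>x. 0 \<le> p x - q x"
  proof
    fix x
    have "p x - q x = 0"
      by (rule nonneg_has_sum_le_0D[OF sub[OF p1 q1]]) (use that in auto)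
    thus "p x = q x" by simp
  qed
  show ?thesis
  proof (cases "\<exists>x. 0 < d x")
    case True
    then obtain x0 where "x0 \<in> {x. 0 < d x}" by blast
    have pos: "x \<in> {x. 0 < d x}" for x
      using P(1) \<open>x0 \<in> {x. 0 < d x}\<close>
    proof (rule no_proper_closed_setD)
      fix x y assume xy: "x \<in> {x. 0 < d x}" "0 < P x y"
      have "((\<lambda>x. d x * P x y) has_sum d x * P x y) {x}" by (intro has_sum_finiteI) auto
      hence "d x * P x y \<le> h y"
        by (rule has_sum_mono_neutral[OF _ h]) (use d0 P(2) in auto)
      moreover have "0 < d x * P x y" using xy by simp
      ultimately have "0 < d y" unfolding hd by linarith
      thus "y \<in> {x. 0 < d x}" by simp
    qed
    show ?thesis by (rule eq) (use pos in \<open>auto simp: d_def less_max_iff_disj intro: less_imp_le\<close>)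
  next
    case False
    hence le: "p x - q x \<le> 0" for x by (auto simp: d_def not_less)
    have "q x - p x = 0" for x
      by (rule nonneg_has_sum_le_0D[OF sub[OF q1 p1]]) (use le in auto)
    thus ?thesis by (auto simp: fun_eq_iff algebra_simps)
  qed
qed

lemma stationary_distribution_eqI:
  assumes "no_proper_closed_set P" "\<And>x y. 0 \<le> P x y" "\<And>x. ((\<lambda>y. P x y) has_sum 1) UNIV"
    and "is_stationary_distribution P p"
  shows "stationary_distribution P = p"
  unfolding stationary_distribution_def
  by (rule the_equality) (use stationary_distribution_unique[OF assms(1-3)] assms(4) in auto)

section \<open>Block tridiagonal chains\<close>

lemma sum_Times: "sum f (A \<times> B) = (\<Sum>a\<in>A. \<Sum>b\<in>B. f (a, b))"
  by (simp add: sum.cartesian_product)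

lemma block_tridiag_row_has_sum:
  assumes B: "(B0 + B1) *v 1 = (1::real^'n)" and DSU: "(D + S + U) *v 1 = (1::real^'n)"
  shows "((\<lambda>y. block_tridiag B0 B1 U S D x y) has_sum 1) UNIV"
proof -
  obtain k i where x: "x = (k, i)" by fastforce
  have B': "(\<Sum>j\<in>UNIV. B0 $ i $ j) + (\<Sum>j\<in>UNIV. B1 $ i $ j) = 1"
    using arg_cong[OF B, of "\<lambda>v. v $ i"] by (simp add: matrix_vector_mult_def sum.distrib)
  have D': "(\<Sum>j\<in>UNIV. D $ i $ j) + (\<Sum>j\<in>UNIV. S $ i $ j) + (\<Sum>j\<in>UNIV. U $ i $ j) = 1"
    using arg_cong[OF DSU, of "\<lambda>v. v $ i"] by (simp add: matrix_vector_mult_def sum.distrib)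
  show ?thesis
  proof (cases k)
    case 0
    have "(\<Sum>y\<in>{0, 1} \<times> UNIV. block_tridiag B0 B1 U S D x y) = 1"
      using B' by (simp add: x 0 sum_Times)
    thus ?thesis
      by (intro has_sum_finite_neutralI[of "{0, 1} \<times> UNIV"]) (auto simp: x 0 split: if_splits)
  next
    case (Suc m)
    have "(\<Sum>y\<in>{m, Suc m, Suc (Suc m)} \<times> UNIV. block_tridiag B0 B1 U S D x y) = 1"
      using D' by (simp add: x Suc sum_Times)
    thus ?thesis
      by (intro has_sum_finite_neutralI[of "{m, Suc m, Suc (Suc m)} \<times> UNIV"]) (auto simp: x Suc split: if_splits)
  qed
qed

text \<open>Each column meets at most three levels, so invariance is a finite identity per level.
  Level 1 is separate because it is entered from below through \<open>B1\<close> instead of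
  \<open>U\<close>.\<close>

lemma block_tridiag_stationaryI:
  fixes p :: "nat \<Rightarrow> real^'n"
  assumes nonneg: "\<And>k. 0 \<le> p k" and mass: "(\<lambda>k. p k \<bullet> 1) sums 1"
    and p0: "p 0 v* B0 + p 1 v* D = p 0" and p1: "p 0 v* B1 + p 1 v* S + p 2 v* D = p 1"
    and pk: "\<And>k. p (Suc k) v* U + p (Suc (Suc k)) v* S + p (Suc (Suc (Suc k))) v* D = p (Suc (Suc k))"
  shows "is_stationary_distribution (block_tridiag B0 B1 U S D) (\<lambda>(k, i). p k $ i)"
  unfolding is_stationary_distribution_def
proof (intro conjI allI)
  fix x show "0 \<le> (case x of (k, i) \<Rightarrow> p k $ i)" using nonneg by (auto simp: vec_le_iff split: prod.split)
next
  have row: "((\<lambda>i. (\<lambda>(k, i). p k $ i) (k, i)) has_sum p k \<bullet> 1) UNIV" for k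
    by (simp add: inner_1 has_sum_finiteI)
  have "((\<lambda>k. p k \<bullet> 1) has_sum 1) UNIV"
    by (rule sums_nonneg_imp_has_sum[OF mass]) (intro inner_nonneg nonneg, simp add: vec_le_iff)
  moreover from this have "(\<lambda>(k, i). p k $ i) summable_on (UNIV \<times> UNIV)"
    by (intro summable_on_SigmaI[OF row]) (use nonneg in \<open>auto simp: summable_on_def vec_le_iff\<close>)
  ultimately have "((\<lambda>(k, i). p k $ i) has_sum 1) (UNIV \<times> UNIV)"
    by (rule has_sum_SigmaI[OF row])
  thus "((\<lambda>(k, i). p k $ i) has_sum 1) UNIV" by simp
next
  fix y :: "nat \<times> 'n"
  obtain l j where y: "y = (l, j)" by fastforce
  let ?f = "\<lambda>x. (case x of (k, i) \<Rightarrow> p k $ i) * block_tridiag B0 B1 U S D x y"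
  have vm: "(v v* M) $ j = (\<Sum>i\<in>UNIV. v $ i * M $ i $ j)" for v :: "real^'n" and M :: "real^'n^'n"
    by (simp add: vector_matrix_mult_def)
  have "\<exists>K. finite K \<and> (\<forall>k. k \<notin> K \<longrightarrow> (\<forall>i. ?f (k, i) = 0)) \<and> (\<Sum>x\<in>K \<times> UNIV. ?f x) = p l $ j"
  proof (cases l)
    case 0
    have "(\<Sum>x\<in>{0, 1} \<times> UNIV. ?f x) = p l $ j"
      using arg_cong[OF p0, of "\<lambda>v. v $ j"] by (simp add: y 0 sum_Times vm)
    thus ?thesis by (intro exI[of _ "{0, 1}"]) (auto simp: y 0)
  next
    case (Suc m)
    show ?thesis
    proof (cases m)
      case 0
      have "(\<Sum>x\<in>{0, 1, 2} \<times> UNIV. ?f x) = p l $ j"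
        using arg_cong[OF p1, of "\<lambda>v. v $ j"] by (simp add: y Suc 0 sum_Times vm)
      thus ?thesis by (intro exI[of _ "{0, 1, 2}"]) (auto simp: y Suc 0)
    next
      case (Suc k)
      have "(\<Sum>x\<in>{Suc k, Suc (Suc k), Suc (Suc (Suc k))} \<times> UNIV. ?f x) = p l $ j"
        using arg_cong[OF pk[of k], of "\<lambda>v. v $ j"]
        by (simp add: y \<open>l = Suc m\<close> Suc sum_Times vm)
      thus ?thesis
        by (intro exI[of _ "{Suc k, Suc (Suc k), Suc (Suc (Suc k))}"]) (auto simp: y \<open>l = Suc m\<close> Suc)
    qed
  qed
  then obtain K where K: "finite K" "\<And>k i. k \<notin> K \<Longrightarrow> ?f (k, i) = 0" "(\<Sum>x\<in>K \<times> UNIV. ?f x) = p l $ j"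
    by blast
  have "(?f has_sum p l $ j) UNIV"
    by (rule has_sum_finite_neutralI[of "K \<times> UNIV"]) (use K in auto)
  thus "(?f has_sum (case y of (k, i) \<Rightarrow> p k $ i)) UNIV" by (simp add: y)
qed

section \<open>Perron eigenvectors\<close>

text \<open>Serves to show that a matrix has finitely many eigenvalues, so that \<open>Max\<close>
  in \<open>spr\<close> is meaningful.\<close>

lemma det_minus_scalar_poly:
  fixes M :: "complex^'n^'n"
  obtains p where "\<And>l. poly p l = det (M - mat l)"
proof
  define p where "p = (\<Sum>\<sigma>\<in>{\<sigma>. \<sigma> permutes (UNIV::'n set)}. of_int (sign \<sigma>) *
     (\<Prod>i\<in>UNIV. [:M $ i $ \<sigma> i, if i = \<sigma> i then - 1 else 0:]))"
  show "poly p l = det (M - mat l)" for l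
    unfolding p_def det_def poly_sum poly_mult poly_prod
    by (intro sum.cong prod.cong arg_cong2[of _ _ _ _ "(*)"] refl) (auto simp: mat_def poly_of_int)
qed

text \<open>A strictly positive eigenvector bounds every eigenvalue by comparison of the ratios
  \<open>cmod (v $ i) / r $ i\<close> at the index where this ratio is maximal.\<close>

lemma spr_eqI:
  fixes M :: "real^'n^'n"
  assumes M: "0 \<le> M" and r: "\<And>i. 0 < r $ i" and ev: "M *v r = \<mu> *\<^sub>R r"
  shows "spr M = \<mu>"
proof -
  define C where "C = (\<chi> i j. complex_of_real (M $ i $ j))"
  define Z where "Z = {l. \<exists>v::complex^'n. v \<noteq> 0 \<and> C *v v = l *s v}"
  have Mr: "(\<Sum>j\<in>UNIV. M $ i $ j * r $ j) = \<mu> * r $ i" for i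
    using arg_cong[OF ev, of "\<lambda>v. v $ i"] by (simp add: matrix_vector_mult_def)
  have mu0: "0 \<le> \<mu>"
  proof -
    have "0 \<le> \<mu> * r $ undefined"
      unfolding Mr[symmetric] using M r by (intro sum_nonneg mult_nonneg_nonneg) (auto simp: matrix_le_iff less_imp_le)
    thus ?thesis using r[of undefined] by (simp add: zero_le_mult_iff)
  qed
  have bound: "cmod l \<le> \<mu>" if "l \<in> Z" for l
  proof -
    from that obtain v :: "complex^'n" where v: "v \<noteq> 0" "C *v v = l *s v"
      unfolding Z_def by blast
    define c where "c = (MAX i. cmod (v $ i) / r $ i)"
    have le: "cmod (v $ i) \<le> c * r $ i" for i
    proof -
      have "cmod (v $ i) / r $ i \<le> c" unfolding c_def by (rule Max_ge) auto
      thus ?thesis using r[of i] by (simp add: divide_le_eq)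
    qed
    have "c \<in> range (\<lambda>i. cmod (v $ i) / r $ i)" unfolding c_def by (rule Max_in) auto
    then obtain i where i: "c = cmod (v $ i) / r $ i" by auto
    hence vi: "cmod (v $ i) = c * r $ i" using r[of i] by simp
    obtain k where "v $ k \<noteq> 0" using v(1) by (auto simp: vec_eq_iff)
    hence "0 < c * r $ k" using le[of k] by (meson less_le_trans zero_less_norm_iff)
    hence c0: "0 < c" using r[of k] by (simp add: zero_less_mult_iff)
    have "l * v $ i = (\<Sum>j\<in>UNIV. complex_of_real (M $ i $ j) * v $ j)"
      using arg_cong[OF v(2), of "\<lambda>v. v $ i"] by (simp add: C_def matrix_vector_mult_def)
    hence "cmod l * cmod (v $ i) \<le> (\<Sum>j\<in>UNIV. cmod (complex_of_real (M $ i $ j) * v $ j))"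
      by (metis norm_mult norm_sum)
    also have "\<dots> \<le> (\<Sum>j\<in>UNIV. c * (M $ i $ j * r $ j))"
    proof (rule sum_mono)
      fix j
      have "0 \<le> M $ i $ j" using M by (simp add: matrix_le_iff)
      thus "cmod (complex_of_real (M $ i $ j) * v $ j) \<le> c * (M $ i $ j * r $ j)"
        using mult_left_mono[OF le[of j], of "M $ i $ j"] by (simp add: norm_mult mult_ac)
    qed
    also have "\<dots> = \<mu> * (c * r $ i)" by (simp add: sum_distrib_left[symmetric] Mr)
    finally have "cmod l * (c * r $ i) \<le> \<mu> * (c * r $ i)" by (simp add: vi)
    thus ?thesis using c0 r[of i] by (simp add: mult_le_cancel_right)
  qed
  have "finite Z"
  proof -
    have det: "l \<in> Z \<longleftrightarrow> det (C - mat l) = 0" for l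
    proof -
      have "mat l *v v = l *s v" for v :: "complex^'n"
        by (simp add: vec_eq_iff matrix_vector_mult_def mat_def if_distrib if_distribR cong: if_cong)
      hence "l \<in> Z \<longleftrightarrow> \<not> (\<forall>v. (C - mat l) *v v = 0 \<longrightarrow> v = 0)"
        by (auto simp: Z_def matrix_vector_mult_diff_rdistrib)
      also have "(\<forall>v. (C - mat l) *v v = 0 \<longrightarrow> v = 0) \<longleftrightarrow> det (C - mat l) \<noteq> 0"
        by (simp only: matrix_left_invertible_ker[symmetric] invertible_left_inverse[symmetric]
          invertible_det_nz)
      finally show ?thesis by simp
    qed
    obtain p where p: "\<And>l. poly p l = det (C - mat l)" using det_minus_scalar_poly by blast
    \<comment> \<open>By \<open>bound\<close>, \<open>\<mu> + 1\<close> is no eigenvalue, so the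
      characteristic polynomial is nonzero; its leading coefficient need not be computed.\<close>
    have notin: "complex_of_real (\<mu> + 1) \<notin> Z" using bound[of "complex_of_real (\<mu> + 1)"] mu0 by (auto simp: norm_of_real)
    have Zp: "Z = {l. poly p l = 0}" by (intro set_eqI) (simp only: mem_Collect_eq p det)
    have "p \<noteq> 0"
    proof
      assume "p = 0"
      hence "Z = UNIV" unfolding Zp by simp
      thus False using notin by simp
    qed
    thus ?thesis unfolding Zp by (rule poly_roots_finite)
  qed
  have "complex_of_real \<mu> \<in> Z"
  proof -
    have "(\<chi> i. complex_of_real (r $ i)) \<noteq> 0"
      using r by (simp add: vec_eq_iff) (metis less_irrefl)
    moreover have "C *v (\<chi> i. complex_of_real (r $ i)) = complex_of_real \<mu> *s (\<chi> i. complex_of_real (r $ i))"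
      by (simp add: vec_eq_iff C_def matrix_vector_mult_def Mr flip: of_real_mult of_real_sum)
    ultimately show ?thesis by (auto simp: Z_def)
  qed
  hence "cmod (complex_of_real \<mu>) \<in> cmod ` Z" by (rule imageI)
  hence "\<mu> \<in> cmod ` Z" using mu0 by (simp only: norm_of_real abs_of_nonneg)
  hence "Max (cmod ` Z) = \<mu>" using \<open>finite Z\<close> bound by (intro Max_eqI) blast+
  moreover have "spr M = Max (cmod ` Z)"
    unfolding spr_def Z_def C_def by (simp only: setcompr_eq_image)
  ultimately show ?thesis by simp
qed

text \<open>Brouwer's theorem on the standard simplex. The map normalizes \<open>x + M *v x\<close>
  instead of \<open>M *v x\<close>: its mass is at least 1 even where \<open>M *v x = 0\<close>, and
  a fixed point is still an eigenvector of \<open>M\<close>.\<close>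

lemma nonneg_eigenvector:
  fixes M :: "real^'n^'n"
  assumes M: "0 \<le> M"
  obtains r \<mu> where "0 \<le> r" "r \<bullet> 1 = 1" "M *v r = \<mu> *\<^sub>R r" "0 \<le> \<mu>"
proof -
  define K where "K = {x::real^'n. 0 \<le> x \<and> x \<bullet> 1 = 1}"
  define f where "f x = (1 / (1 + (M *v x) \<bullet> 1)) *\<^sub>R (x + M *v x)" for x
  have s0: "0 \<le> (M *v x) \<bullet> 1" if "x \<in> K" for x
    using that by (intro inner_nonneg mvec_nonneg M) (auto simp: K_def vec_le_iff)
  obtain r where r: "r \<in> K" "f r = r"
  proof (rule brouwer[of K f])
    have "norm x \<le> 1" if "x \<in> K" for x
    proof -
      have "norm x \<le> (\<Sum>i\<in>UNIV. \<bar>x $ i\<bar>)" by (rule norm_le_l1_cart)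
      thus ?thesis using that by (simp add: K_def inner_1 vec_le_iff)
    qed
    hence "bounded K" unfolding bounded_iff by blast
    moreover have "closed K"
      unfolding K_def vec_le_iff
      by (simp, intro closed_Collect_conj closed_Collect_all closed_Collect_le closed_Collect_eq continuous_intros)
    ultimately show "compact K" by (simp add: compact_eq_bounded_closed)
    show "convex K"
      by (rule convexI) (auto simp: K_def inner_add_left intro!: add_nonneg_nonneg scaleR_nonneg_nonneg)
    have "axis undefined 1 \<in> K" by (auto simp: K_def vec_le_iff axis_def inner_1)
    thus "K \<noteq> {}" by auto
    show "continuous_on K f"
      unfolding f_def
      by (intro continuous_intros mvec.continuous_on) (use s0 in \<open>force simp: add_nonneg_eq_0_iff\<close>)
    show "f \<in> K \<rightarrow> K"
    proof
      fix x assume x: "x \<in> K"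
      have "0 \<le> f x" unfolding f_def
        by (intro scaleR_nonneg_nonneg add_nonneg_nonneg mvec_nonneg M) (use x s0[OF x] in \<open>auto simp: K_def\<close>)
      moreover have "f x \<bullet> 1 = 1" using x s0[OF x] by (simp add: f_def K_def inner_add_left)
      ultimately show "f x \<in> K" by (simp add: K_def)
    qed
  qed
  define \<mu> where "\<mu> = (M *v r) \<bullet> 1"
  have mu0: "0 \<le> \<mu>" using s0[OF r(1)] by (simp add: \<mu>_def)
  have "(1 + \<mu>) *\<^sub>R f r = r + M *v r" using mu0 by (simp add: f_def \<mu>_def)
  hence "M *v r = \<mu> *\<^sub>R r" by (simp add: r(2) scaleR_add_left)
  with r(1) mu0 show ?thesis using that by (auto simp: K_def)
qed

text \<open>Testing the eigenvector equation of \<open>K z\<close> against the left eigenvector \<open>q\<close> of \<open>K 1\<close> gives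
  \<open>spr (K z) - 1 = q \<bullet> ((K z - K 1) *v r z)\<close>, where \<open>r z\<close> is normalized by \<open>q \<bullet> r z = 1\<close> and tends
  to the vector of ones.\<close>

lemma spr_has_slope:
  fixes K :: "real \<Rightarrow> real^'n^'n"
  assumes K1: "0 \<le> K 1" "K 1 *v 1 = 1"
    and q: "\<And>i. 0 < q $ i" "q \<bullet> 1 = 1" "q v* K 1 = q"
    and const: "\<And>r. K 1 *v r = r \<Longrightarrow> \<exists>c. r = c *\<^sub>R 1"
    and slope: "K has_slope K'" and nn: "\<forall>\<^sub>F z in at 1. 0 \<le> K z"
  shows "(\<lambda>z. spr (K z)) has_slope (q \<bullet> (K' *v 1))"
proof -
  \<comment> \<open>At this stage \<open>r\<close> may have zero entries and \<mu> is just some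
    eigenvalue. Normalizing by the positive vector \<open>q\<close> makes the eigenvectors uniformly
    bounded.\<close>
  have "\<exists>r \<mu>. 0 \<le> r \<and> q \<bullet> r = 1 \<and> K z *v r = \<mu> *\<^sub>R r" if K0: "0 \<le> K z" for z
  proof -
    obtain r \<mu> where r: "0 \<le> r" "r \<bullet> 1 = 1" "K z *v r = \<mu> *\<^sub>R r"
      using nonneg_eigenvector[OF K0] by blast
    have "r \<noteq> 0" using r(2) by auto
    then obtain i where "0 < r $ i" using r(1) by (auto simp: vec_eq_iff vec_le_iff less_le)
    hence "0 < q $ i * r $ i" using q(1) by simp
    also have "\<dots> \<le> (\<Sum>i\<in>UNIV. q $ i * r $ i)"
      by (rule member_le_sum) (use q(1) r(1) in \<open>auto simp: vec_le_iff less_imp_le\<close>)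
    finally have "0 < q \<bullet> r" by (simp add: inner_vec_def)
    thus ?thesis using r
      by (intro exI[of _ "(1 / (q \<bullet> r)) *\<^sub>R r"] exI[of _ \<mu>]) (auto simp: matrix_algebra intro!: scaleR_nonneg_nonneg)
  qed
  then obtain r \<mu> where r: "\<And>z. 0 \<le> K z \<Longrightarrow> 0 \<le> r z" "\<And>z. 0 \<le> K z \<Longrightarrow> q \<bullet> r z = 1"
      "\<And>z. 0 \<le> K z \<Longrightarrow> K z *v r z = \<mu> z *\<^sub>R r z"
    by metis
  define \<Delta> where "\<Delta> z = K z - K 1" for z
  have \<mu>: "\<mu> z - 1 = q \<bullet> (\<Delta> z *v r z)" if "0 \<le> K z" for z
    using r(2,3)[OF that] by (simp add: \<Delta>_def matrix_algebra inner_diff_right dot_lmul_matrix[symmetric] q)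
  obtain e where e: "0 < e" "\<And>i. \<bar>1 / q $ i\<bar> \<le> e" using finite_uniform_bound[of "\<lambda>i. 1 / q $ i"] by blast
  have rb: "norm (r z) \<le> e" if "0 \<le> K z" for z
  proof -
    have "norm (r z) \<le> (\<Sum>i\<in>UNIV. \<bar>r z $ i\<bar>)" by (rule norm_le_l1_cart)
    also have "\<dots> \<le> (\<Sum>i\<in>UNIV. e * (q $ i * r z $ i))"
    proof (rule sum_mono)
      fix i
      have "1 \<le> e * q $ i" using e(2)[of i] q(1)[of i] by (simp add: field_simps)
      from mult_right_mono[OF this, of "r z $ i"] show "\<bar>r z $ i\<bar> \<le> e * (q $ i * r z $ i)"
        using vec_ge_0D[OF r(1)[OF that], of i] by simp
    qed
    also have "\<dots> = e" using r(2)[OF that] by (simp add: sum_distrib_left[symmetric] inner_vec_def)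
    finally show ?thesis .
  qed
  obtain C where C: "0 < C" "\<And>(A::real^'n^'n) (x::real^'n). norm (A *v x) \<le> norm A * norm x * C"
    using mvec.pos_bounded by blast
  have \<Delta>0: "(\<Delta> \<longlongrightarrow> 0) (at 1)"
    unfolding \<Delta>_def by (rule LIM_zero[OF has_slope_tendsto[OF slope]])
  have \<Delta>r0: "((\<lambda>z. \<Delta> z *v r z) \<longlongrightarrow> 0) (at 1)"
  proof (rule Lim_null_comparison)
    show "\<forall>\<^sub>F z in at 1. norm (\<Delta> z *v r z) \<le> norm (\<Delta> z) * (e * C)"
      using nn
    proof eventually_elim
      case (elim z)
      have "norm (\<Delta> z *v r z) \<le> norm (\<Delta> z) * (norm (r z) * C)" using C(2)[of "\<Delta> z" "r z"] by (simp add: mult_ac)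
      also have "\<dots> \<le> norm (\<Delta> z) * (e * C)"
        using C rb[OF elim] by (intro mult_left_mono mult_right_mono) auto
      finally show ?case .
    qed
    show "((\<lambda>z. norm (\<Delta> z) * (e * C)) \<longlongrightarrow> 0) (at 1)"
      by (intro tendsto_mult_left_zero tendsto_norm_zero \<Delta>0)
  qed
  have \<mu>0: "((\<lambda>z. 1 - \<mu> z) \<longlongrightarrow> 0) (at 1)"
  proof -
    have "((\<lambda>z. - (q \<bullet> (\<Delta> z *v r z))) \<longlongrightarrow> - (q \<bullet> 0)) (at 1)"
      by (intro tendsto_minus tendsto_inner tendsto_const \<Delta>r0)
    hence "((\<lambda>z. - (q \<bullet> (\<Delta> z *v r z))) \<longlongrightarrow> 0) (at 1)" by simp
    moreover have "\<forall>\<^sub>F z in at 1. - (q \<bullet> (\<Delta> z *v r z)) = 1 - \<mu> z"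
      using nn by eventually_elim (simp add: \<mu>[symmetric])
    ultimately show ?thesis by (rule Lim_transform_eventually)
  qed
  have \<mu>r0: "((\<lambda>z. (1 - \<mu> z) *\<^sub>R r z) \<longlongrightarrow> 0) (at 1)"
  proof (rule Lim_null_comparison)
    show "\<forall>\<^sub>F z in at 1. norm ((1 - \<mu> z) *\<^sub>R r z) \<le> norm (1 - \<mu> z) * e"
      using nn
    proof eventually_elim
      case (elim z)
      show ?case using rb[OF elim] by (simp add: mult_left_mono)
    qed
    show "((\<lambda>z. norm (1 - \<mu> z) * e) \<longlongrightarrow> 0) (at 1)"
      by (intro tendsto_mult_left_zero tendsto_norm_zero \<mu>0)
  qed
  obtain B :: "real^'n^'n" where B: "\<And>x. B *v (x - K 1 *v x + (q \<bullet> x) *\<^sub>R 1) = x"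
    using rank_one_correction_inverse[OF q(2,3) K1(2) const] by blast
  have r1: "(r \<longlongrightarrow> 1) (at 1)"
  proof -
    have "((\<lambda>z. B *v ((1 - \<mu> z) *\<^sub>R r z + \<Delta> z *v r z) + 1) \<longlongrightarrow> B *v (0 + 0) + 1) (at 1)"
      by (intro tendsto_add mvec.tendsto tendsto_const \<mu>r0 \<Delta>r0)
    hence "((\<lambda>z. B *v ((1 - \<mu> z) *\<^sub>R r z + \<Delta> z *v r z) + 1) \<longlongrightarrow> 1) (at 1)" by simp
    moreover have "\<forall>\<^sub>F z in at 1. B *v ((1 - \<mu> z) *\<^sub>R r z + \<Delta> z *v r z) + 1 = r z"
      using nn
    proof eventually_elim
      case (elim z)
      \<comment> \<open>The correction term vanishes since
        \<open>q \<bullet> r z = q \<bullet> 1\<close>, and the right-hand side tends to 0; the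
        inverse \<open>B\<close> then forces \<open>r z\<close> to tend to the vector of
        ones.\<close>
      have "r z - 1 - K 1 *v (r z - 1) + (q \<bullet> (r z - 1)) *\<^sub>R 1 = (1 - \<mu> z) *\<^sub>R r z + \<Delta> z *v r z"
        using r(2,3)[OF elim] K1(2) q(2)
        by (simp add: \<Delta>_def matrix_algebra inner_diff_right scaleR_diff_left)
      with B[of "r z - 1"] show ?case by simp
    qed
    ultimately show ?thesis by (rule Lim_transform_eventually)
  qed
  \<comment> \<open>Strict positivity near 1 is what identifies \<open>\<mu> z\<close> with the
    spectral radius.\<close>
  have "\<forall>\<^sub>F z in at 1. 0 < r z $ i" for i
  proof (rule order_tendstoD)
    show "((\<lambda>z. r z $ i) \<longlongrightarrow> 1 $ i) (at 1)" by (intro tendsto_vec_nth r1)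
  qed simp
  hence "\<forall>\<^sub>F z in at 1. \<forall>i. 0 < r z $ i" by (simp add: eventually_all_finite)
  hence spr: "\<forall>\<^sub>F z in at 1. spr (K z) = \<mu> z"
    using nn by eventually_elim (rule spr_eqI, auto simp: r(3))
  have spr1: "spr (K 1) = 1" by (rule spr_eqI[OF K1(1), of 1]) (simp_all add: K1)
  have "((\<lambda>z. q \<bullet> (((1 / (z - 1)) *\<^sub>R (K z - K 1)) *v r z)) \<longlongrightarrow> q \<bullet> (K' *v 1)) (at 1)"
    by (intro tendsto_inner mvec.tendsto tendsto_const slope r1)
  moreover have "\<forall>\<^sub>F z in at 1. q \<bullet> (((1 / (z - 1)) *\<^sub>R (K z - K 1)) *v r z)
      = (1 / (z - 1)) *\<^sub>R (spr (K z) - spr (K 1))"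
    using spr nn
  proof eventually_elim
    case (elim z)
    have "q \<bullet> (((1 / (z - 1)) *\<^sub>R (K z - K 1)) *v r z) = (1 / (z - 1)) * (q \<bullet> (\<Delta> z *v r z))"
      unfolding \<Delta>_def by (simp only: mvec.scaleR_left inner_scaleR_right)
    thus ?case using elim \<mu> spr1 by simp
  qed
  ultimately show ?thesis by (rule Lim_transform_eventually)
qed

section \<open>Negative drift\<close>

text \<open>Solving the Poisson equation \<open>v - P v = (U - D) 1 - a 1\<close> for the drift \<open>a < 0\<close> and the phase
  chain \<open>P = D + S + U\<close>, the function \<open>(1 + \<delta>) ^ k * (1 + \<delta> * v $ i)\<close> decays to first order in \<open>\<delta>\<close>.\<close>

lemma negative_drift_imp_downward_qbd:
  fixes D S U :: "real^'n^'n"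
  assumes nn: "0 \<le> D" "0 \<le> S" "0 \<le> U" and row: "(D + S + U) *v 1 = 1"
    and q: "q \<bullet> 1 = 1" "q v* (D + S + U) = q"
    and const: "\<And>r. (D + S + U) *v r = r \<Longrightarrow> \<exists>c. r = c *\<^sub>R 1"
    and drift: "q \<bullet> ((- D + U) *v 1) < 0"
  shows "\<exists>x \<rho> w. downward_qbd D S U x \<rho> w"
proof -
  define a where "a = q \<bullet> ((- D + U) *v 1)"
  define y where "y = (- D + U) *v 1 - a *\<^sub>R 1"
  obtain B :: "real^'n^'n" where B: "\<And>x. B *v x - (D + S + U) *v (B *v x) + (q \<bullet> (B *v x)) *\<^sub>R 1 = x"
    using rank_one_correction_inverse[OF q row const] by blast
  define v where "v = B *v y"
  have v: "v - (D + S + U) *v v + (q \<bullet> v) *\<^sub>R 1 = y" using B[of y] by (simp add: v_def)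
  have "q \<bullet> (v - (D + S + U) *v v + (q \<bullet> v) *\<^sub>R 1) = q \<bullet> v"
    by (simp add: inner_add_right inner_diff_right q dot_lmul_matrix[symmetric] del: vector_matrix_mult_add_rdistrib)
  hence "q \<bullet> v = q \<bullet> y" by (simp only: v)
  also have "q \<bullet> y = 0" using q(1) by (simp add: y_def inner_diff_right a_def)
  finally have poisson: "(D + S + U) *v v = v - ((- D + U) *v 1 - a *\<^sub>R 1)"
    using v by (simp add: y_def algebra_simps)
  \<comment> \<open>In (1 + \<delta>) (1 + \<delta> v) minus \<open>lhs \<delta>\<close>, order 0
    cancels by the row sums, order 1 is \<open>- a\<close> by the Poisson equation, and orders 2 and
    3 are \<open>c\<close> and \<open>- (U *v v)\<close>.\<close>
  define c where "c = v - S *v v - 2 *\<^sub>R (U *v v) - U *v 1"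
  define lhs where "lhs \<delta> = D *v (1 + \<delta> *\<^sub>R v) + (1 + \<delta>) *\<^sub>R (S *v (1 + \<delta> *\<^sub>R v))
    + (1 + \<delta>)\<^sup>2 *\<^sub>R (U *v (1 + \<delta> *\<^sub>R v))" for \<delta>
  have expand: "(1 + \<delta>) *\<^sub>R (1 + \<delta> *\<^sub>R v) - lhs \<delta> = \<delta> *\<^sub>R ((- a) *\<^sub>R 1 + \<delta> *\<^sub>R c - \<delta>\<^sup>2 *\<^sub>R (U *v v))" for \<delta>
  proof -
    have 1: "(D *v v) $ i = v $ i - (- (D *v 1) $ i + (U *v 1) $ i - a) - (S *v v) $ i - (U *v v) $ i" for i
      using arg_cong[OF poisson, of "\<lambda>u. u $ i"] by (simp add: matrix_algebra)
    have 2: "(S *v 1) $ i = 1 - (D *v 1) $ i - (U *v 1) $ i" for i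
      using arg_cong[OF row, of "\<lambda>u. u $ i"] by (simp add: matrix_algebra)
    show ?thesis
      unfolding lhs_def c_def vec_eq_iff
      by (simp add: matrix_algebra 1 2 algebra_simps power2_eq_square)
  qed
  have "\<forall>\<^sub>F \<delta> in at_right 0. 0 < - a + \<delta> * c $ i - \<delta>\<^sup>2 * (U *v v) $ i" for i
  proof (rule order_tendstoD)
    show "((\<lambda>\<delta>. - a + \<delta> * c $ i - \<delta>\<^sup>2 * (U *v v) $ i) \<longlongrightarrow> - a + 0 * c $ i - 0\<^sup>2 * (U *v v) $ i) (at_right 0)"
      by (intro tendsto_intros)
  qed (use drift in \<open>simp add: a_def\<close>)
  moreover have "\<forall>\<^sub>F \<delta> in at_right 0. 0 < 1 + \<delta> * v $ i" for i
  proof (rule order_tendstoD)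
    show "((\<lambda>\<delta>. 1 + \<delta> * v $ i) \<longlongrightarrow> 1 + 0 * v $ i) (at_right 0)" by (intro tendsto_intros)
  qed simp
  moreover have "\<forall>\<^sub>F \<delta> in at_right 0. (0::real) < \<delta>" by (rule eventually_at_right_less)
  ultimately have "\<forall>\<^sub>F \<delta> in at_right 0. (\<forall>i. 0 < - a + \<delta> * c $ i - \<delta>\<^sup>2 * (U *v v) $ i) \<and>
      (\<forall>i. 0 < 1 + \<delta> * v $ i) \<and> 0 < \<delta>"
    by (simp add: eventually_conj_iff eventually_all_finite)
  from eventually_happens'[OF _ this] obtain \<delta> where \<delta>:
    "\<And>i. 0 < - a + \<delta> * c $ i - \<delta>\<^sup>2 * (U *v v) $ i" "\<And>i. 0 < 1 + \<delta> * v $ i" "0 < \<delta>"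
    by (auto simp: trivial_limit_at_right_real)
  define x where "x = 1 + \<delta>"
  define w where "w = 1 + \<delta> *\<^sub>R v"
  have x: "1 < x" using \<delta> by (simp add: x_def)
  have w: "0 < w $ i" for i using \<delta>(2) by (simp add: w_def)
  have lhs: "lhs \<delta> $ i < x * w $ i" for i
  proof -
    have "x * w $ i - lhs \<delta> $ i = \<delta> * (- a + \<delta> * c $ i - \<delta>\<^sup>2 * (U *v v) $ i)"
      using arg_cong[OF expand[of \<delta>], of "\<lambda>u. u $ i"] by (simp add: x_def w_def)
    also have "0 < \<dots>" using \<delta>(1)[of i] \<delta>(3) by (rule mult_pos_pos[rotated])
    finally show ?thesis by simp
  qed
  define \<rho> where "\<rho> = max (1 / 2) (MAX i. lhs \<delta> $ i / (x * w $ i))"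
  have "(MAX i. lhs \<delta> $ i / (x * w $ i)) < 1"
    using lhs w x by (subst Max_less_iff) auto
  hence \<rho>: "0 < \<rho>" "\<rho> < 1" by (simp_all add: \<rho>_def)
  have "lhs \<delta> $ i \<le> \<rho> * x * w $ i" for i
  proof -
    have "lhs \<delta> $ i / (x * w $ i) \<le> (MAX i. lhs \<delta> $ i / (x * w $ i))" by (rule Max_ge) auto
    also have "\<dots> \<le> \<rho>" by (simp add: \<rho>_def)
    finally show ?thesis using x w[of i] by (simp add: divide_le_eq mult_ac)
  qed
  hence "D *v w + x *\<^sub>R (S *v w) + x\<^sup>2 *\<^sub>R (U *v w) \<le> (\<rho> * x) *\<^sub>R w"
    by (simp add: vec_le_iff lhs_def x_def w_def)
  hence "downward_qbd D S U x \<rho> w"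
    using nn row x \<rho> w by unfold_locales auto
  thus ?thesis by blast
qed

section \<open>The chain censored at level 0\<close>

lemma mvec_eq_0D:
  fixes M :: "real^'n^'n"
  assumes "0 \<le> M" "0 \<le> y" "(M *v y) $ i = 0" "0 < M $ i $ j"
  shows "y $ j = 0"
proof -
  have "M $ i $ j * y $ j = 0"
    using assms(1-3) by (simp add: matrix_vector_mult_def sum_nonneg_eq_0_iff matrix_le_iff vec_le_iff)
  thus ?thesis using assms(4) by simp
qed

locale reflected_qbd = downward_qbd D S U x \<rho> w
  for D S U :: "real^'n^'n" and x \<rho> w +
  fixes B0 B1 :: "real^'n^'n"
  assumes B0: "0 \<le> B0" and B1: "0 \<le> B1" and B_row: "(B0 + B1) *v 1 = 1"
    and irred: "no_proper_closed_set (block_tridiag B0 B1 U S D)"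
begin

definition "K = B0 + B1 ** G"

lemma K_nonneg: "0 \<le> K"
  unfolding K_def by (intro add_nonneg_nonneg mmul_nonneg B0 B1 G_nonneg)

lemma K_stochastic: "K *v 1 = 1"
  using B_row by (simp add: K_def matrix_algebra G_stochastic)

text \<open>A fixed vector \<open>r\<close> of \<open>K\<close> extends to the harmonic function \<open>(k, i) \<mapsto> (G ^ k r) $ i\<close>, whose
  minimum is attained at level 0; minimum principle.\<close>

lemma K_fixed_const:
  assumes r: "K *v r = r"
  shows "\<exists>c. r = c *\<^sub>R 1"
proof -
  define c where "c = (MIN i. r $ i)"
  define g where "g = rec_nat (r - c *\<^sub>R 1) (\<lambda>_ y. G *v y)"
  have g0: "g 0 = r - c *\<^sub>R 1" and gS: "g (Suc k) = G *v g k" for k by (simp_all add: g_def)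
  have "c \<le> r $ i" for i unfolding c_def by (rule Min_le) auto
  hence "0 \<le> g 0" by (simp add: g0 vec_le_iff)
  hence gn: "0 \<le> g k" for k by (induction k) (simp_all add: gS mvec_nonneg[OF G_nonneg])
  have "c \<in> range (\<lambda>i. r $ i)" unfolding c_def by (rule Min_in) auto
  then obtain i0 where i0: "g 0 $ i0 = 0" by (auto simp: g0)
  have h0: "B0 *v g 0 + B1 *v g 1 = g 0"
  proof -
    have "B0 *v g 0 + B1 *v g 1 = K *v g 0" by (simp add: K_def gS matrix_algebra)
    also have "\<dots> = g 0" by (simp add: g0 matrix_algebra r K_stochastic)
    finally show ?thesis .
  qed
  have hS: "D *v g k + S *v g (Suc k) + U *v g (Suc (Suc k)) = g (Suc k)" for k
  proof -
    have "D *v g k + S *v g (Suc k) + U *v g (Suc (Suc k)) = (D + S ** G + U ** (G ** G)) *v g k"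
      by (simp add: gS matrix_algebra)
    thus ?thesis by (simp only: G_eq gS)
  qed
  \<comment> \<open>One step of the minimum principle: where a sum of nonnegative terms vanishes,
    each term does, so \<open>y\<close> vanishes at every index that \<open>M\<close> reaches from
    \<open>i\<close>.\<close>
  have zero: "y $ j = 0" if "u = y' + M *v y + z'" "0 \<le> y'" "0 \<le> z'" "u $ i = 0" "0 \<le> M" "0 \<le> y" "0 < M $ i $ j"
    for u y y' z' :: "real^'n" and M i j
  proof (rule mvec_eq_0D[OF \<open>0 \<le> M\<close> \<open>0 \<le> y\<close> _ \<open>0 < M $ i $ j\<close>])
    have "y' $ i + (M *v y) $ i + z' $ i = 0" using that(1,4) by simp
    moreover have "0 \<le> y' $ i" "0 \<le> (M *v y) $ i" "0 \<le> z' $ i"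
      using that mvec_nonneg[of M y] by (auto intro: vec_ge_0D)
    ultimately show "(M *v y) $ i = 0" by linarith
  qed
  have all: "x \<in> {(k, i). g k $ i = 0}" for x
    using irred
  proof (rule no_proper_closed_setD)
    show "(0, i0) \<in> {(k, i). g k $ i = 0}" using i0 by simp
    fix x y :: "nat \<times> 'n"
    assume xC: "x \<in> {(k, i). g k $ i = 0}" and xy: "0 < block_tridiag B0 B1 U S D x y"
    obtain k i l j where xy': "x = (k, i)" "y = (l, j)" by fastforce
    have gk: "g k $ i = 0" using xC xy' by simp
    have nn: "0 \<le> D *v g m" "0 \<le> S *v g m" "0 \<le> U *v g m" "0 \<le> B0 *v g m" "0 \<le> B1 *v g m" for m
      by (intro mvec_nonneg D S U B0 B1 gn)+
    have "g l $ j = 0"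
    proof (cases k)
      case 0
      consider "l = 0" "0 < B0 $ i $ j" | "l = 1" "0 < B1 $ i $ j"
        using xy by (auto simp: xy' 0 split: if_splits)
      thus ?thesis
      proof cases
        case 1
        show ?thesis by (rule zero[of "g k" 0 B0 _ "B1 *v g 1"]) (use 1 0 h0 gk nn gn B0 in simp_all)
      next
        case 2
        show ?thesis by (rule zero[of "g k" "B0 *v g 0" B1 _ 0]) (use 2 0 h0 gk nn gn B1 in simp_all)
      qed
    next
      case (Suc m)
      consider "l = m" "0 < D $ i $ j" | "l = Suc m" "0 < S $ i $ j" | "l = Suc (Suc m)" "0 < U $ i $ j"
        using xy by (auto simp: xy' Suc split: if_splits)
      thus ?thesis
      proof cases
        case 1
        show ?thesis
          by (rule zero[of "g k" 0 D _ "S *v g (Suc m) + U *v g (Suc (Suc m))"])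
             (use 1 Suc hS[of m] gk nn gn D in \<open>simp_all add: add.assoc\<close>)
      next
        case 2
        show ?thesis
          by (rule zero[of "g k" "D *v g m" S _ "U *v g (Suc (Suc m))"])
             (use 2 Suc hS[of m] gk nn gn S in simp_all)
      next
        case 3
        show ?thesis
          by (rule zero[of "g k" "D *v g m + S *v g (Suc m)" U _ 0])
             (use 3 Suc hS[of m] gk nn gn U in simp_all)
      qed
    qed
    thus "y \<in> {(k, i). g k $ i = 0}" by (simp add: xy')
  qed
  have "g 0 $ i = 0" for i using all[of "(0, i)"] by simp
  hence "r = c *\<^sub>R 1" by (simp add: g0 vec_eq_iff)
  thus ?thesis by blast
qed

text \<open>The balance equations hold at level 0 by the invariance of \<open>q\<close> and
  \<open>N ** D = G\<close>, at level 1 because \<open>N\<close> inverts \<open>mat 1 - V\<close>,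
  and above by the equation for \<open>R\<close>. Uniqueness then identifies the normalized vector.
  As \<open>q\<close> has mass 1, \<open>t\<close> is the stationary probability of level 0.\<close>

lemma stationary_distribution_levels:
  obtains q t where "\<And>i. 0 < q $ i" "q \<bullet> 1 = 1" "q v* K = q" "0 < t"
    "\<And>i. stationary_distribution (block_tridiag B0 B1 U S D) (0, i) = t * q $ i"
    "\<And>i. stationary_distribution (block_tridiag B0 B1 U S D) (1, i) = t * (q v* B1 v* N) $ i"
proof -
  obtain q where q: "0 \<le> q" "q \<bullet> 1 = 1" "q v* K = q"
    by (rule stochastic_left_eigenvector[OF K_nonneg K_stochastic])
  define r where "r = rec_nat (q v* B1 v* N) (\<lambda>_ y. y v* R)"
  have r0: "r 0 = q v* B1 v* N" and rS: "r (Suc k) = r k v* R" for k by (simp_all add: r_def)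
  have r_nn: "0 \<le> r k" for k
    by (induction k) (simp_all add: r0 rS vecm_nonneg q B1 N_nonneg R_nonneg)
  define p where "p k = (case k of 0 \<Rightarrow> q | Suc k \<Rightarrow> r k)" for k
  have p0: "p 0 = q" and pS: "p (Suc k) = r k" for k by (simp_all add: p_def)
  have p_nn: "0 \<le> p k" for k using r_nn q(1) by (cases k) (simp_all add: p0 pS)
  have r_D: "r (Suc k) v* D = r k v* (U ** G)" for k
    by (simp add: rS vector_matrix_mul_assoc R_D)
  have eq0: "p 0 v* B0 + p 1 v* D = p 0"
    using q(3) by (simp add: p0 pS r0 vector_matrix_mul_assoc N_D K_def vector_matrix_mult_add_rdistrib
      matrix_mul_assoc[symmetric])
  have eq1: "p 0 v* B1 + p 1 v* S + p 2 v* D = p 1"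
  proof -
    have "r 0 v* (mat 1 - V) = q v* B1"
      by (simp add: r0 vector_matrix_mul_assoc matrix_mul_assoc[symmetric] N_left)
    hence "q v* B1 + r 0 v* S + r 0 v* (U ** G) = r 0"
      by (simp add: V_def vector_matrix_mult_diff_rdistrib vector_matrix_mult_add_rdistrib algebra_simps)
    thus ?thesis using r_D[of 0] by (simp add: p0 pS numeral_2_eq_2)
  qed
  have eqS: "p (Suc k) v* U + p (Suc (Suc k)) v* S + p (Suc (Suc (Suc k))) v* D = p (Suc (Suc k))" for k
  proof -
    have "r k v* U + r (Suc k) v* S + r (Suc (Suc k)) v* D = r k v* (U + R ** S + R ** R ** D)"
      by (simp add: rS vector_matrix_mul_assoc vector_matrix_mult_add_rdistrib matrix_mul_assoc)
    thus ?thesis by (simp add: pS rS R_eq[symmetric])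
  qed
  define W where "W = matrix_inv (mat 1 - R)"
  \<comment> \<open>Bounds the partial sums without convergence of the powers of \<open>R\<close>:
    the remainder \<open>r n \<bullet> (W *v 1)\<close> is nonnegative and is dropped.\<close>
  have telescope: "(\<Sum>k<n. r k) v* (mat 1 - R) = r 0 - r n" for n
  proof (induction n)
    case (Suc n)
    have "(\<Sum>k<Suc n. r k) v* (mat 1 - R) = (\<Sum>k<n. r k) v* (mat 1 - R) + (r n - r (Suc n))"
      by (simp add: rS vector_matrix_left_distrib vector_matrix_mult_diff_rdistrib)
    thus ?case using Suc by simp
  qed simp
  have "(\<Sum>k<n. r k \<bullet> 1) \<le> r 0 \<bullet> (W *v 1)" for n
  proof -
    have "(\<Sum>k<n. r k) = (\<Sum>k<n. r k) v* ((mat 1 - R) ** W)" by (simp add: W_def I_R_inverse)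
    also have "\<dots> = (r 0 - r n) v* W" by (simp only: vector_matrix_mul_assoc[symmetric] telescope)
    finally have "(\<Sum>k<n. r k) \<bullet> 1 = (r 0 - r n) \<bullet> (W *v 1)" by (simp add: dot_lmul_matrix)
    hence "(\<Sum>k<n. r k \<bullet> 1) = r 0 \<bullet> (W *v 1) - r n \<bullet> (W *v 1)"
      by (simp add: inner_sum_left inner_diff_left)
    moreover have "0 \<le> r n \<bullet> (W *v 1)"
      by (intro inner_nonneg r_nn mvec_nonneg) (simp_all add: W_def I_R_inverse vec_le_iff)
    ultimately show ?thesis by simp
  qed
  moreover have r1: "0 \<le> r k \<bullet> 1" for k by (intro inner_nonneg r_nn) (simp add: vec_le_iff)
  ultimately have "summable (\<lambda>k. r k \<bullet> 1)"
    by (intro summableI_nonneg_bounded[where x="r 0 \<bullet> (W *v 1)"])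
  hence summ: "summable (\<lambda>k. p k \<bullet> 1)" by (subst summable_Suc_iff[symmetric]) (simp add: pS)
  define s where "s = (\<Sum>k. p k \<bullet> 1)"
  have s1: "1 \<le> s"
  proof -
    have "(\<Sum>k\<in>{0}. p k \<bullet> 1) \<le> s" unfolding s_def
      by (rule sum_le_suminf[OF summ]) (auto intro!: inner_nonneg p_nn simp: vec_le_iff)
    thus ?thesis by (simp add: p0 q)
  qed
  define t where "t = 1 / s"
  have t: "0 < t" using s1 by (simp add: t_def)
  have sums: "(\<lambda>k. (t *\<^sub>R p k) \<bullet> 1) sums 1"
    using sums_mult[OF summable_sums[OF summ], of t] s1 by (simp add: s_def[symmetric] t_def)
  have stat: "is_stationary_distribution (block_tridiag B0 B1 U S D) (\<lambda>(k, i). (t *\<^sub>R p k) $ i)"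
  proof (rule block_tridiag_stationaryI[OF _ sums])
    show "0 \<le> t *\<^sub>R p k" for k using t p_nn by (intro scaleR_nonneg_nonneg) auto
  qed (simp_all only: scaleR_vector_matrix_assoc scaleR_add_right[symmetric] eq0 eq1 eqS)
  have nn: "0 \<le> block_tridiag B0 B1 U S D x y" for x y
    using D S U B0 B1 by (cases x; cases y) (auto simp: matrix_le_iff)
  have rows: "((\<lambda>y. block_tridiag B0 B1 U S D x y) has_sum 1) UNIV" for x
    by (rule block_tridiag_row_has_sum[OF B_row row])
  note eq = stationary_distribution_eqI[OF irred nn rows stat]
  \<comment> \<open>Strict positivity of \<open>q\<close> is read off from the irreducible chain on
    all levels.\<close>
  have pos: "0 < q $ i" for i
    using stationary_distribution_pos[OF irred nn stat, of "(0, i)"] t by (simp add: p0 zero_less_mult_iff)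
  show ?thesis
    by (rule that[OF pos q(2,3) t]) (simp_all add: eq p0 pS[of 0, simplified] r0)
qed

text \<open>Differentiating the equation for \<open>G\<close> and applying it to the vector of ones gives
  \<open>(mat 1 - T) *v (G' *v 1) = d\<close>, and \<open>mat 1 - T = (mat 1 - R) ** (mat 1 - V)\<close>.\<close>

lemma spr_censored_has_slope:
  fixes Dz Sz Uz B0z B1z :: "real \<Rightarrow> real^'n^'n"
  assumes at_1: "Dz 1 = D" "Sz 1 = S" "Uz 1 = U" "B0z 1 = B0" "B1z 1 = B1"
    and slope: "Dz has_slope D'" "Sz has_slope S'" "Uz has_slope U'" "B0z has_slope B0'" "B1z has_slope B1'"
    and nn: "\<forall>\<^sub>F z in at 1. 0 \<le> Dz z \<and> 0 \<le> Sz z \<and> 0 \<le> Uz z" "\<forall>\<^sub>F z in at 1. 0 \<le> B0z z \<and> 0 \<le> B1z z"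
    and q: "\<And>i. 0 < q $ i" "q \<bullet> 1 = 1" "q v* K = q"
  shows "(\<lambda>z. spr (B0z z + B1z z ** G_min (Uz z) (Sz z) (Dz z))) has_slope
    (q \<bullet> ((B0' + B1') *v 1) + (q v* B1 v* N v* matrix_inv (mat 1 - R)) \<bullet> ((D' + S' + U') *v 1))"
proof -
  define Gz where "Gz z = G_min (Uz z) (Sz z) (Dz z)" for z
  have G1: "Gz 1 = G" by (simp add: Gz_def at_1 G_def)
  obtain G' where G': "Gz has_slope G'" "L G' = D' + S' ** G + U' ** (G ** G)"
    "\<forall>\<^sub>F z in at 1. 0 \<le> Gz z"
    using G_min_has_slope[OF at_1(1-3) slope(1-3) nn(1)] unfolding Gz_def by blast
  define Kz where "Kz z = B0z z + B1z z ** Gz z" for z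
  have K1: "Kz 1 = K" by (simp add: Kz_def at_1 G1 K_def)
  have "((\<lambda>z. (1 / (z - 1)) *\<^sub>R (B0z z - B0z 1) + ((1 / (z - 1)) *\<^sub>R (B1z z - B1z 1)) ** Gz z
      + B1 ** ((1 / (z - 1)) *\<^sub>R (Gz z - Gz 1))) \<longlongrightarrow> B0' + B1' ** Gz 1 + B1 ** G') (at 1)"
    by (intro tendsto_add mmul.tendsto tendsto_const slope(4,5) G'(1) has_slope_tendsto[OF G'(1)])
  moreover have "(1 / (z - 1)) *\<^sub>R (B0z z - B0z 1) + ((1 / (z - 1)) *\<^sub>R (B1z z - B1z 1)) ** Gz z
      + B1 ** ((1 / (z - 1)) *\<^sub>R (Gz z - Gz 1)) = (1 / (z - 1)) *\<^sub>R (Kz z - Kz 1)" for z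
    by (simp only: mmul.scaleR_left mmul.scaleR_right scaleR_add_right[symmetric])
       (simp add: Kz_def at_1 mmul.diff_left mmul.diff_right)
  ultimately have Kslope: "Kz has_slope (B0' + B1' ** G + B1 ** G')" by (simp only: G1)
  have Knn: "\<forall>\<^sub>F z in at 1. 0 \<le> Kz z"
    using nn(2) G'(3) by eventually_elim (auto simp: Kz_def intro!: add_nonneg_nonneg mmul_nonneg)
  have "(\<lambda>z. spr (Kz z)) has_slope (q \<bullet> ((B0' + B1' ** G + B1 ** G') *v 1))"
  proof (rule spr_has_slope[OF _ _ q(1,2) _ _ Kslope Knn])
    show "\<exists>c. r = c *\<^sub>R 1" if "Kz 1 *v r = r" for r using K_fixed_const that by (simp only: K1)
  qed (simp_all only: K1 K_nonneg K_stochastic q)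
  moreover have "q \<bullet> ((B0' + B1' ** G + B1 ** G') *v 1) =
      q \<bullet> ((B0' + B1') *v 1) + (q v* B1 v* N v* matrix_inv (mat 1 - R)) \<bullet> ((D' + S' + U') *v 1)"
  proof -
    have "L G' *v 1 = (mat 1 - T) *v (G' *v 1)"
      by (simp add: L_def T_def matrix_algebra G_stochastic)
    also have "\<dots> = (mat 1 - R) *v ((mat 1 - V) *v (G' *v 1))"
      by (simp only: I_T_factor matrix_vector_mul_assoc[symmetric])
    finally have "(mat 1 - R) *v ((mat 1 - V) *v (G' *v 1)) = (D' + S' + U') *v 1"
      unfolding G'(2) by (simp add: matrix_algebra G_stochastic)
    hence "matrix_inv (mat 1 - R) *v ((D' + S' + U') *v 1) = (mat 1 - V) *v (G' *v 1)"
      by (metis I_R_inverse(2) matrix_vector_mul_assoc matrix_vector_mul_lid)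
    hence "N *v (matrix_inv (mat 1 - R) *v ((D' + S' + U') *v 1)) = G' *v 1"
      by (metis N_left matrix_vector_mul_assoc matrix_vector_mul_lid)
    hence "(q v* B1 v* N v* matrix_inv (mat 1 - R)) \<bullet> ((D' + S' + U') *v 1) = q \<bullet> (B1 *v (G' *v 1))"
      by (simp only: dot_lmul_matrix)
    thus ?thesis by (simp add: matrix_algebra G_stochastic inner_add_right)
  qed
  ultimately show ?thesis by (simp only: Kz_def Gz_def)
qed

end

section \<open>The two-dimensional process\<close>

lemma col_gf_1: "col_gf A j 1 = col_sum A j"
  by (simp add: col_gf_def col_sum_def)

lemma col_gf_nonneg:
  assumes "\<And>i. i \<in> HH \<Longrightarrow> 0 \<le> A i j" "0 < z"
  shows "0 \<le> col_gf A j z"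
  unfolding col_gf_def by (intro sum_nonneg scaleR_nonneg_nonneg assms) (use assms(2) in simp)

lemma eventually_at_1_pos: "\<forall>\<^sub>F z in at 1. (0::real) < z"
  by (rule order_tendstoD[OF tendsto_ident_at]) simp

lemma col_gf_has_slope: "col_gf A j has_slope (A 1 j - A (-1) j)"
proof -
  have "((\<lambda>z. A 1 j - inverse z *\<^sub>R A (-1) j) \<longlongrightarrow> A 1 j - inverse 1 *\<^sub>R A (-1) j) (at (1::real))"
    by (intro tendsto_intros) simp
  moreover have "\<forall>\<^sub>F z in at (1::real). A 1 j - inverse z *\<^sub>R A (-1) j = (1 / (z - 1)) *\<^sub>R (col_gf A j z - col_gf A j 1)"
  proof -
    have "\<forall>\<^sub>F z in at 1. z \<noteq> (1::real)" by (simp add: eventually_at_filter)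
    thus ?thesis using eventually_at_1_pos
    proof eventually_elim
      case (elim z)
      have "col_gf A j z - col_gf A j 1 = (z - 1) *\<^sub>R A 1 j + (inverse z - 1) *\<^sub>R A (-1) j"
        by (simp add: col_gf_def algebra_simps power_int_minus)
      also have "(inverse z - 1) = - ((z - 1) * inverse z)" using elim by (simp add: field_simps)
      finally show ?case using elim by (simp add: scaleR_diff_right)
    qed
  qed
  ultimately show ?thesis by (simp add: Lim_transform_eventually)
qed

lemma sum_HH_entry_pos:
  assumes "i \<in> HH" "\<And>i. i \<in> HH \<Longrightarrow> 0 \<le> (f i :: real^'n^'n)" "0 < f i $ j $ k"
  shows "0 < (\<Sum>i\<in>HH. f i) $ j $ k"
proof -
  have "0 < (\<Sum>i\<in>HH. f i $ j $ k)"
    by (rule sum_pos2[of _ i]) (use assms in \<open>auto intro: mat_ge_0D\<close>)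
  thus ?thesis by simp
qed

lemma phase_no_proper_closed_set:
  assumes PT: "no_proper_closed_set (PT A)" and nn: "\<And>i j. i \<in> HH \<Longrightarrow> j \<in> HH \<Longrightarrow> 0 \<le> A i j"
  shows "no_proper_closed_set (\<lambda>i j. (\<Sum>k\<in>HH. \<Sum>l\<in>HH. A k l) $ i $ j)"
proof (rule no_proper_closed_set_image[OF PT, where f="\<lambda>(x1, x2, j). j"])
  show "surj (\<lambda>(x1 :: int, x2 :: int, j :: 'a). j)" by (rule surjI[of _ "\<lambda>j. (0, 0, j)"]) simp
  fix x y assume xy: "0 < PT A x y"
  obtain x1 x2 j y1 y2 k where e: "x = (x1, x2, j)" "y = (y1, y2, k)" by (metis prod_cases3)
  from xy have h: "y1 - x1 \<in> HH" "y2 - x2 \<in> HH" "0 < A (y1 - x1) (y2 - x2) $ j $ k"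
    unfolding e PT.simps by (auto split: if_splits)
  have row_nn: "\<And>k. k \<in> HH \<Longrightarrow> 0 \<le> (\<Sum>l\<in>HH. A k l)"
    by (rule sum_nonneg) (rule nn)
  have row_pos: "0 < (\<Sum>l\<in>HH. A (y1 - x1) l) $ j $ k"
    using h(2) nn[OF h(1)] h(3) by (rule sum_HH_entry_pos)
  have "0 < (\<Sum>k\<in>HH. \<Sum>l\<in>HH. A k l) $ j $ k"
    using h(1) row_nn row_pos by (rule sum_HH_entry_pos)
  thus "0 < (\<Sum>k\<in>HH. \<Sum>l\<in>HH. A k l) $ (case x of (x1, x2, j) \<Rightarrow> j) $ (case y of (x1, x2, j) \<Rightarrow> j)"
    by (simp only: e prod.case)
qed

lemma level_no_proper_closed_set:
  assumes PT1: "no_proper_closed_set (PT1 A A1)"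
    and nn: "\<And>i j. i \<in> HH \<Longrightarrow> j \<in> HH \<Longrightarrow> 0 \<le> A i j" "\<And>i j. i \<in> HH \<Longrightarrow> j \<in> HHp \<Longrightarrow> 0 \<le> A1 i j"
  shows "no_proper_closed_set (block_tridiag (col_sum A1 0) (col_sum A1 1) (col_sum A 1) (col_sum A 0) (col_sum A (-1)))"
proof (rule no_proper_closed_set_image[OF PT1, where f="\<lambda>(x1, x2, j). (x2, j)"])
  show "surj (\<lambda>(x1 :: int, x2 :: nat, j :: 'a). (x2, j))" by (rule surjI[of _ "\<lambda>(x2, j). (0, x2, j)"]) auto
  fix x y assume xy: "0 < PT1 A A1 x y"
  obtain x1 x2 j y1 y2 k where e: "x = (x1, x2, j)" "y = (y1, y2, k)" by (metis prod_cases3)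
  from xy have h: "y1 - x1 \<in> HH" "int y2 - int x2 \<in> HH"
      "0 < (if x2 \<noteq> 0 then A else A1) (y1 - x1) (int y2 - int x2) $ j $ k"
    unfolding e PT1.simps by (auto split: if_splits)
  have A: "0 < col_sum A m $ j $ k" if "m \<in> HH" "0 < A (y1 - x1) m $ j $ k" for m
    unfolding col_sum_def using h(1) nn(1)[OF _ that(1)] that(2) by (rule sum_HH_entry_pos)
  have A1: "0 < col_sum A1 m $ j $ k" if "m \<in> HHp" "0 < A1 (y1 - x1) m $ j $ k" for m
    unfolding col_sum_def using h(1) nn(2)[OF _ that(1)] that(2) by (rule sum_HH_entry_pos)
  have "0 < block_tridiag (col_sum A1 0) (col_sum A1 1) (col_sum A 1) (col_sum A 0) (col_sum A (-1)) (x2, j) (y2, k)"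
  proof (cases "x2 = 0")
    case True
    have "int y2 = 0 \<or> int y2 = 1" using h(2) True by auto
    hence "y2 = 0 \<or> y2 = 1" by linarith
    thus ?thesis using h(3) A1[of 0] A1[of 1] True by auto
  next
    case False
    have "int y2 - int x2 = -1 \<or> int y2 - int x2 = 0 \<or> int y2 - int x2 = 1" using h(2) by blast
    hence "y2 + 1 = x2 \<or> y2 = x2 \<or> y2 = x2 + 1" by linarith
    moreover have ?thesis if "y2 + 1 = x2" using h(3) A[of "-1"] False that by (auto simp flip: that)
    moreover have ?thesis if "y2 = x2" using h(3) A[of 0] False that by auto
    moreover have ?thesis if "y2 = x2 + 1" using h(3) A[of 1] False that by auto
    ultimately show ?thesis by blast
  qed
  thus "0 < block_tridiag (col_sum A1 0) (col_sum A1 1) (col_sum A 1) (col_sum A 0) (col_sum A (-1))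
      (case x of (x1, x2, j) \<Rightarrow> (x2, j)) (case y of (x1, x2, j) \<Rightarrow> (x2, j))"
    by (simp only: e prod.case)
qed

text \<open>Minimum principle: the zero set of \<open>r\<close> minus its minimum is nonempty and
  closed under transitions.\<close>

lemma irreducible_stochastic_fixed_const:
  fixes P :: "real^'n^'n"
  assumes irred: "no_proper_closed_set (\<lambda>i j. P $ i $ j)" and P: "0 \<le> P" "P *v 1 = 1" and r: "P *v r = r"
  shows "\<exists>c. r = c *\<^sub>R 1"
proof -
  define c where "c = (MIN i. r $ i)"
  define y where "y = r - c *\<^sub>R 1"
  have "c \<le> r $ i" for i unfolding c_def by (rule Min_le) auto
  hence y0: "0 \<le> y" by (simp add: y_def vec_le_iff)
  have Py: "P *v y = y" by (simp add: y_def matrix_algebra P r)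
  have "c \<in> range (\<lambda>i. r $ i)" unfolding c_def by (rule Min_in) auto
  then obtain i0 where "i0 \<in> {i. y $ i = 0}" by (auto simp: y_def)
  have "i \<in> {i. y $ i = 0}" for i
    using irred \<open>i0 \<in> {i. y $ i = 0}\<close>
    by (rule no_proper_closed_setD) (use mvec_eq_0D[OF P(1) y0] Py in auto)
  hence "r = c *\<^sub>R 1" by (simp add: y_def vec_eq_iff)
  thus ?thesis by blast
qed

lemma finite_stationary_distribution_eqI:
  fixes P :: "real^'n^'n"
  assumes irred: "no_proper_closed_set (\<lambda>i j. P $ i $ j)" and P: "0 \<le> P" "P *v 1 = 1"
    and q: "0 \<le> q" "q \<bullet> 1 = 1" "q v* P = q"
  shows "stationary_distribution (\<lambda>i j. P $ i $ j) = (\<lambda>i. q $ i)"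
proof (rule stationary_distribution_eqI[OF irred])
  show "0 \<le> P $ i $ j" for i j using P(1) by (rule mat_ge_0D)
  show "((\<lambda>j. P $ i $ j) has_sum 1) UNIV" for i
    using arg_cong[OF P(2), of "\<lambda>v. v $ i"] by (intro has_sum_finiteI) (simp_all add: matrix_vector_mult_def)
  have "q $ j = (\<Sum>i\<in>UNIV. q $ i * P $ i $ j)" for j
    by (subst q(3)[symmetric]) (simp add: vector_matrix_mult_def)
  hence "((\<lambda>i. q $ i * P $ i $ j) has_sum q $ j) UNIV" for j by (rule has_sum_finiteI[OF finite])
  moreover have "((\<lambda>i. q $ i) has_sum 1) UNIV"
    using q(2) by (intro has_sum_finiteI) (simp_all add: inner_1)
  ultimately show "is_stationary_distribution (\<lambda>i j. P $ i $ j) (\<lambda>i. q $ i)"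
    unfolding is_stationary_distribution_def using vec_ge_0D[OF q(1)] by blast
qed

text \<open>Irreducibility of the phase chain turns the sign of \<open>a2_12 A\<close> into a
  Lyapunov function, which opens both locales. The generating functions have as slopes at 1 the
  blocks with first index 1 minus those with first index -1, so the slope of the censored chain is
  the drift formula up to the normalization of \<open>q\<close>.\<close>

lemma psi1_has_derivative:
  fixes A A1 :: "int \<Rightarrow> int \<Rightarrow> real^'n^'n"
  assumes nn: "\<And>i j. i \<in> HH \<Longrightarrow> j \<in> HH \<Longrightarrow> 0 \<le> A i j" "\<And>i j. i \<in> HH \<Longrightarrow> j \<in> HHp \<Longrightarrow> 0 \<le> A1 i j"
    and row_sums: "(\<Sum>i\<in>HH. \<Sum>j\<in>HH. A i j) *v 1 = 1" "(\<Sum>i\<in>HH. \<Sum>j\<in>HHp. A1 i j) *v 1 = 1"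
    and irred: "no_proper_closed_set (PT A)" "no_proper_closed_set (PT1 A A1)"
    and drift: "a2_12 A < 0"
  shows "\<exists>c>0. (psi1 A A1 has_real_derivative c * a1_1 A A1) (at 1)"
proof -
  let ?P = "\<Sum>i\<in>HH. \<Sum>j\<in>HH. A i j"
  let ?D = "col_sum A (-1)" and ?S = "col_sum A 0" and ?U = "col_sum A 1"
  let ?B0 = "col_sum A1 0" and ?B1 = "col_sum A1 1"
  have P: "?D + ?S + ?U = ?P" and B: "?B0 + ?B1 = (\<Sum>i\<in>HH. \<Sum>j\<in>HHp. A1 i j)"
    by (simp_all add: col_sum_def add_ac)
  have nonneg: "0 \<le> ?D" "0 \<le> ?S" "0 \<le> ?U" "0 \<le> ?B0" "0 \<le> ?B1"
    unfolding col_sum_def by (intro sum_nonneg nn; simp)+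
  have P0: "0 \<le> ?P" by (intro sum_nonneg nn)
  note phase = phase_no_proper_closed_set[OF irred(1) nn(1)]
  have const: "\<exists>c. r = c *\<^sub>R 1" if "(?D + ?S + ?U) *v r = r" for r
    using phase P0 row_sums(1) that[unfolded P] by (rule irreducible_stochastic_fixed_const[where P="?P"])
  obtain q0 where q0: "0 \<le> q0" "q0 \<bullet> 1 = 1" "q0 v* ?P = q0"
    by (rule stochastic_left_eigenvector[OF P0 row_sums(1)])
  have "pi_inner A = q0"
    by (simp only: pi_inner_def finite_stationary_distribution_eqI[OF phase P0 row_sums(1) q0] vec_lambda_eta)
  hence "q0 \<bullet> ((- ?D + ?U) *v 1) < 0" using drift by (simp add: a2_12_def)
  then obtain x \<rho> w where "downward_qbd ?D ?S ?U x \<rho> w"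
    using negative_drift_imp_downward_qbd[OF nonneg(1-3) _ q0(2) _ const] row_sums(1) q0(3) P by metis
  then interpret downward_qbd ?D ?S ?U x \<rho> w .
  interpret reflected_qbd ?D ?S ?U x \<rho> w ?B0 ?B1
    by unfold_locales (use nonneg row_sums(2) B level_no_proper_closed_set[OF irred(2) nn] in simp_all)
  obtain q t where q: "\<And>i. 0 < q $ i" "q \<bullet> 1 = 1" "q v* K = q" and t: "0 < t"
    and pi: "\<And>i. stationary_distribution (block_tridiag ?B0 ?B1 ?U ?S ?D) (0, i) = t * q $ i"
      "\<And>i. stationary_distribution (block_tridiag ?B0 ?B1 ?U ?S ?D) (1, i) = t * (q v* ?B1 v* N) $ i"
    using stationary_distribution_levels by blast
  have pos: "\<forall>\<^sub>F z in at 1. 0 \<le> col_gf A (-1) z \<and> 0 \<le> col_gf A 0 z \<and> 0 \<le> col_gf A 1 z"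
    "\<forall>\<^sub>F z in at 1. 0 \<le> col_gf A1 0 z \<and> 0 \<le> col_gf A1 1 z"
    using eventually_at_1_pos by (eventually_elim, intro conjI col_gf_nonneg nn; simp)+
  let ?d = "q \<bullet> ((A1 1 0 - A1 (-1) 0 + (A1 1 1 - A1 (-1) 1)) *v 1) +
     (q v* ?B1 v* N v* matrix_inv (mat 1 - R)) \<bullet>
     ((A 1 (-1) - A (-1) (-1) + (A 1 0 - A (-1) 0) + (A 1 1 - A (-1) 1)) *v 1)"
  have "psi1 A A1 has_slope ?d"
    using spr_censored_has_slope[OF col_gf_1 col_gf_1 col_gf_1 col_gf_1 col_gf_1
      col_gf_has_slope col_gf_has_slope col_gf_has_slope col_gf_has_slope col_gf_has_slope pos q]
    by (simp only: psi1_def G1_def)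
  hence "(psi1 A A1 has_real_derivative ?d) (at 1)"
    by (simp add: has_field_derivative_iff)
  \<comment> \<open>The vectors \<open>pi1 A A1 0\<close> and \<open>pi1 A A1 1\<close> are
    \<open>t\<close> times \<open>q\<close> and \<open>q v* ?B1 v* N\<close>; this is the origin of
    the constant \<open>1 / t\<close>.\<close>
  moreover have "?d = 1 / t * a1_1 A A1"
  proof -
    have "pi1 A A1 0 = t *\<^sub>R q" "pi1 A A1 1 = t *\<^sub>R (q v* ?B1 v* N)"
      by (simp_all only: pi1_def pi) (simp_all add: vec_eq_iff)
    moreover have "R1 A = R" by (simp only: R1_def R_min_eq)
    moreover have "- A1 (-1) 0 - A1 (-1) 1 + A1 1 0 + A1 1 1 = A1 1 0 - A1 (-1) 0 + (A1 1 1 - A1 (-1) 1)"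
      by simp
    moreover have "- row_sum A (-1) + row_sum A 1 =
        A 1 (-1) - A (-1) (-1) + (A 1 0 - A (-1) 0) + (A 1 1 - A (-1) 1)"
      by (simp add: row_sum_def)
    ultimately have "a1_1 A A1 = t * ?d"
      by (simp only: a1_1_def scaleR_vector_matrix_assoc inner_scaleR_left distrib_left)
    thus ?thesis using t by simp
  qed
  ultimately show ?thesis using t by (intro exI[of _ "1 / t"]) simp
qed

theorem lemma2p5:
  fixes A A1 A2 A0 :: "int \<Rightarrow> int \<Rightarrow> real^'n^'n"
  assumes "qbd_blocks A A1 A2 A0"
    and "irreducible_chain (PY A A1 A2 A0)" and "aperiodic_chain (PY A A1 A2 A0)"
    and "irreducible_chain (PT A)" and "aperiodic_chain (PT A)"
    and "irreducible_chain (PT1 A A1)" and "aperiodic_chain (PT1 A A1)"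
    and "irreducible_chain (PT2 A A2)" and "aperiodic_chain (PT2 A A2)"
    and "irreducible_matrix (rate_matrix1 A A1 A2 A0)"
    and "irreducible_matrix (rate_matrix2 A A1 A2 A0)"
    and "drift_condition A A1 A2"
  shows "(a2_12 A < 0 \<longrightarrow>
            (\<exists>c1>0. (psi1 A A1 has_real_derivative c1 * a1_1 A A1) (at 1))) \<and>
         (a1_12 A < 0 \<longrightarrow>
            (\<exists>c2>0. (psi2 A A2 has_real_derivative c2 * a2_2 A A2) (at 1)))"
proof (intro conjI impI)
  note blocks = assms(1)[unfolded qbd_blocks_def stochastic_matrix_def]
  note irred = irreducible_chain_imp_no_proper_closed_set[OF assms(4)]
    irreducible_chain_imp_no_proper_closed_set[OF assms(6)]
    irreducible_chain_imp_no_proper_closed_set[OF assms(8)]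
  {
    assume "a2_12 A < 0"
    thus "\<exists>c1>0. (psi1 A A1 has_real_derivative c1 * a1_1 A A1) (at 1)"
      by (intro psi1_has_derivative irred(1,2)) (use blocks in blast)+
  }
  assume drift: "a1_12 A < 0"
  \<comment> \<open>Exchanging the block indices exchanges the coordinates: row sums become column
    sums, and the second claim becomes the first one for \<open>A'\<close> and
    \<open>A2'\<close>.\<close>
  define A' A2' where "A' = (\<lambda>i j. A j i)" and "A2' = (\<lambda>i j. A2 j i)"
  have gf: "row_gf A = col_gf A'" "row_gf A2 = col_gf A2'"
    and sums: "row_sum A = col_sum A'" "row_sum A2 = col_sum A2'" "col_sum A = row_sum A'"
    by (simp_all add: fun_eq_iff row_gf_def col_gf_def row_sum_def col_sum_def A'_def A2'_def)
  have swap: "(\<Sum>i\<in>I. \<Sum>j\<in>J. A i j) = (\<Sum>i\<in>J. \<Sum>j\<in>I. A' i j)"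
    "(\<Sum>i\<in>I. \<Sum>j\<in>J. A2 i j) = (\<Sum>i\<in>J. \<Sum>j\<in>I. A2' i j)" for I J
    by (simp_all only: A'_def A2'_def sum.swap[of _ J I])
  have "pi_inner A = pi_inner A'" by (simp only: pi_inner_def swap)
  hence a: "a1_12 A = a2_12 A'" by (simp only: a1_12_def a2_12_def sums)
  have psi: "psi2 A A2 = psi1 A' A2'"
    by (intro ext) (simp only: psi1_def psi2_def G1_def G2_def gf)
  have "a2_2 A A2 = a1_1 A' A2'"
    by (simp only: a1_1_def a2_2_def pi1_def pi2_def R1_def R2_def sums) (simp only: A2'_def)
  moreover have "\<exists>c>0. (psi1 A' A2' has_real_derivative c * a1_1 A' A2') (at 1)"
  proof (rule psi1_has_derivative)
    show "no_proper_closed_set (PT A')"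
    proof (rule no_proper_closed_set_image[OF irred(1), where f="\<lambda>(x1, x2, j). (x2, x1, j)"])
      show "surj (\<lambda>(x1 :: int, x2 :: int, j :: 'n). (x2, x1, j))"
        by (rule surjI[of _ "\<lambda>(x1, x2, j). (x2, x1, j)"]) auto
    qed (auto simp: A'_def split: if_splits)
    show "no_proper_closed_set (PT1 A' A2')"
    proof (rule no_proper_closed_set_image[OF irred(3), where f="\<lambda>(x1, x2, j). (x2, x1, j)"])
      show "surj (\<lambda>(x1 :: nat, x2 :: int, j :: 'n). (x2, x1, j))"
        by (rule surjI[of _ "\<lambda>(x1, x2, j). (x2, x1, j)"]) auto
    qed (auto simp: A'_def A2'_def split: if_splits)
    show "0 \<le> A' i j" if "i \<in> HH" "j \<in> HH" for i j using blocks that unfolding A'_def by blast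
    show "0 \<le> A2' i j" if "i \<in> HH" "j \<in> HHp" for i j using blocks that unfolding A2'_def by blast
  qed (use blocks drift in \<open>simp_all only: swap[symmetric] a[symmetric]\<close>)
  ultimately show "\<exists>c2>0. (psi2 A A2 has_real_derivative c2 * a2_2 A A2) (at 1)"
    by (simp only: psi)
qed

end
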